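(* Let $k\ge 1$ and let $F(z_1,\dots,z_k)$ be a nonzero Laurent polynomial with complex coefficients. Then the set $\mathcal M(F)$ is a closed subset of $\mathbb R$. Moreover, $\mathcal M(F)=\overline{\mathcal M_1(F)}$, the closure of $\mathcal M_1(F)$ in $\mathbb R$.
   Context: For a nonzero complex Laurent polynomial $G$ in $\ell\ge 0$ variables, its (logarithmic) Mahler measure is $$m(G)=\int_0^1\cdots\int_0^1\log|G(e^{2\pi i t_1},\dots,e^{2\pi i t_\ell})|\,dt_1\cdots dt_\ell,$$ so $m(G)=\log|G|$ when $\ell=0$ ($G$ a nonzero constant). For $\ell\ge 0$ and $A=(a_{ij})\in\mathbb Z^{\ell\times k}$, put $$(z_1,\dots,z_\ell)^A=(z_1^{a_{11}}\cdots z_\ell^{a_{\ell 1}},\ \dots,\ z_1^{a_{1k}}\cdots z_\ell^{a_{\ell k}}),$$ a $k$-tuple of monomials (equal to $(1,\dots,1)$ when $\ell=0$), and define the Laurent polynomial in $\ell$ variables $F_A(z_1,\dots,z_\ell)=F((z_1,\dots,z_\ell)^A)$. In particular, for a row vector $\mathbf r=(r_1,\dots,r_k)\in\mathbb Z^k$ (the case $\ell=1$), $F_{\mathbf r}(z)=F(z^{r_1},\dots,z^{r_k})$. Define $$\mathcal M(F)=\{m(F_A) : A\in\mathbb Z^{\ell\times k},\ \ell\ge 0,\ F_A\neq 0\},\qquad \mathcal M_1(F)=\{m(F_{\mathbf r}) : \mathbf r\in\mathbb Z^k,\ F_{\mathbf r}\ne 0\}.$$ *)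

theory Defs
  imports
    "HOL-Library.Poly_Mapping"
    "Jordan_Normal_Form.Matrix"
    "HOL-Analysis.Analysis"
begin

text \<open>
  A Laurent polynomial is a finitely supported map from exponent vectors to
  coefficients, an exponent vector being itself a finitely supported map from
  variable indices to \<open>int\<close>. The variables \<open>z\<^sub>1, \<dots>, z\<^sub>k\<close> have the
  indices \<open>0, \<dots>, k - 1\<close>.
\<close>

type_synonym laurent = "(nat \<Rightarrow>\<^sub>0 int) \<Rightarrow>\<^sub>0 complex"

definition laurent_polys :: "nat \<Rightarrow> laurent set" where
  "laurent_polys k = {F. \<forall>m \<in> Poly_Mapping.keys F. Poly_Mapping.keys m \<subseteq> {..<k}}"

definition laurent_eval :: "laurent \<Rightarrow> (nat \<Rightarrow> complex) \<Rightarrow> complex" where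
  "laurent_eval F z =
     (\<Sum>m \<in> Poly_Mapping.keys F. Poly_Mapping.lookup F m *
       (\<Prod>i \<in> Poly_Mapping.keys m. z i powi Poly_Mapping.lookup m i))"

text \<open>
  The product measure is that of the unit cube with \<open>l\<close> coordinates; it is the
  unit point mass for \<open>l = 0\<close>. The convention \<open>ln 0 = 0\<close> only matters on the
  zero set of \<open>G\<close>, which is a null set when \<open>G\<close> is nonzero.
\<close>

definition mahler_measure :: "nat \<Rightarrow> laurent \<Rightarrow> real" where
  "mahler_measure l G =
     (LINT t | (\<Pi>\<^sub>M i\<in>{..<l}. restrict_space lborel {0..1::real}).
        ln (cmod (laurent_eval G (\<lambda>i. exp (2 * of_real pi * \<i> * of_real (t i))))))"

text \<open>
  The substitution \<open>F\<^sub>A(z) = F(z\<^sup>A)\<close>: the \<open>m\<close>-th power product of the tuple of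
  monomials \<open>z\<^sup>A\<close> is the monomial whose exponent vector is the matrix-vector
  product of \<open>A\<close> and \<open>m\<close>. Distinct monomials of \<open>F\<close> may be mapped to the same
  monomial, so terms can collect or cancel. The agreement with evaluation is
  \<open>laurent_eval_subst\<close> below.
\<close>

definition mat_exponent :: "int mat \<Rightarrow> (nat \<Rightarrow>\<^sub>0 int) \<Rightarrow> (nat \<Rightarrow>\<^sub>0 int)" where
  "mat_exponent A m =
     (\<Sum>i<dim_row A. Poly_Mapping.single i
       (\<Sum>j<dim_col A. A $$ (i, j) * Poly_Mapping.lookup m j))"

definition laurent_subst :: "laurent \<Rightarrow> int mat \<Rightarrow> laurent" where
  "laurent_subst F A =
     (\<Sum>m \<in> Poly_Mapping.keys F.
       Poly_Mapping.single (mat_exponent A m) (Poly_Mapping.lookup F m))"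

definition monomial_tuple :: "(nat \<Rightarrow> complex) \<Rightarrow> int mat \<Rightarrow> nat \<Rightarrow> complex" where
  "monomial_tuple z A j = (\<Prod>i<dim_row A. z i powi (A $$ (i, j)))"

definition mahler_set :: "nat \<Rightarrow> laurent \<Rightarrow> real set" where
  "mahler_set k F =
     {mahler_measure l (laurent_subst F A) | l A.
        A \<in> carrier_mat l k \<and> laurent_subst F A \<noteq> 0}"

definition mahler_set1 :: "nat \<Rightarrow> laurent \<Rightarrow> real set" where
  "mahler_set1 k F =
     {mahler_measure 1 (laurent_subst F (mat_of_row r)) | r.
        r \<in> carrier_vec k \<and> laurent_subst F (mat_of_row r) \<noteq> 0}"

lemma lookup_mat_exponent:
  "Poly_Mapping.lookup (mat_exponent A m) i =
     (if i < dim_row A then \<Sum>j<dim_col A. A $$ (i, j) * Poly_Mapping.lookup m j else 0)"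
  by (simp add: mat_exponent_def lookup_sum lookup_single when_def)

lemma keys_mat_exponent: "Poly_Mapping.keys (mat_exponent A m) \<subseteq> {..<dim_row A}"
proof
  fix i assume "i \<in> Poly_Mapping.keys (mat_exponent A m)"
  then have "Poly_Mapping.lookup (mat_exponent A m) i \<noteq> 0"
    by (simp add: in_keys_iff)
  then show "i \<in> {..<dim_row A}"
    by (simp add: lookup_mat_exponent split: if_splits)
qed

lemma laurent_subst_in_laurent_polys:
  assumes "A \<in> carrier_mat l k"
  shows "laurent_subst F A \<in> laurent_polys l"
proof -
  have "Poly_Mapping.keys (laurent_subst F A)
      \<subseteq> (\<Union>m\<in>Poly_Mapping.keys F. {mat_exponent A m})"
    unfolding laurent_subst_def
    by (rule order_trans[OF keys_sum]) (auto split: if_splits)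
  then show ?thesis
    using keys_mat_exponent[of A] assms by (fastforce simp: laurent_polys_def)
qed

lemma laurent_eval_superset:
  assumes "finite S" "Poly_Mapping.keys F \<subseteq> S"
  shows "laurent_eval F z =
    (\<Sum>m\<in>S. Poly_Mapping.lookup F m *
       (\<Prod>i \<in> Poly_Mapping.keys m. z i powi Poly_Mapping.lookup m i))"
  unfolding laurent_eval_def
  by (rule sum.mono_neutral_left) (use assms in \<open>auto simp: in_keys_iff\<close>)

lemma laurent_eval_add:
  "laurent_eval (F + G) z = laurent_eval F z + laurent_eval G z"
proof -
  let ?S = "Poly_Mapping.keys F \<union> Poly_Mapping.keys G"
  have "Poly_Mapping.keys (F + G) \<subseteq> ?S"
    by (rule keys_add)
  then show ?thesis
    using laurent_eval_superset[of ?S "F + G" z] laurent_eval_superset[of ?S F z]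
      laurent_eval_superset[of ?S G z]
    by (simp add: lookup_add algebra_simps sum.distrib)
qed

lemma laurent_eval_sum:
  "laurent_eval (\<Sum>x\<in>S. f x) z = (\<Sum>x\<in>S. laurent_eval (f x) z)"
  by (induction S rule: infinite_finite_induct)
    (auto simp: laurent_eval_add, simp_all add: laurent_eval_def)

lemma laurent_eval_single:
  "laurent_eval (Poly_Mapping.single m c) z =
    c * (\<Prod>i \<in> Poly_Mapping.keys m. z i powi Poly_Mapping.lookup m i)"
  by (simp add: laurent_eval_def)

lemma powi_sum:
  fixes x :: complex
  assumes "x \<noteq> 0"
  shows "x powi (\<Sum>j\<in>S. f j) = (\<Prod>j\<in>S. x powi f j)"
  by (induction S rule: infinite_finite_induct) (auto simp: power_int_add assms)

lemma powi_prod: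
  fixes f :: "nat \<Rightarrow> complex"
  shows "(\<Prod>j\<in>S. f j) powi n = (\<Prod>j\<in>S. f j powi n)"
  by (induction S rule: infinite_finite_induct) (auto simp: power_int_mult_distrib)

lemma laurent_eval_subst:
  assumes A: "A \<in> carrier_mat l k" and F: "F \<in> laurent_polys k"
    and z: "\<And>i. i < l \<Longrightarrow> z i \<noteq> 0"
  shows "laurent_eval (laurent_subst F A) z = laurent_eval F (monomial_tuple z A)"
proof -
  have dims: "dim_row A = l" "dim_col A = k"
    using A by auto
  have "(\<Prod>i \<in> Poly_Mapping.keys (mat_exponent A m).
          z i powi Poly_Mapping.lookup (mat_exponent A m) i)
      = (\<Prod>j \<in> Poly_Mapping.keys m. monomial_tuple z A j powi Poly_Mapping.lookup m j)"
    if m: "m \<in> Poly_Mapping.keys F" for m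
  proof -
    have km: "Poly_Mapping.keys m \<subseteq> {..<k}"
      using F m by (auto simp: laurent_polys_def)
    have "(\<Prod>i \<in> Poly_Mapping.keys (mat_exponent A m).
          z i powi Poly_Mapping.lookup (mat_exponent A m) i)
        = (\<Prod>i<l. z i powi Poly_Mapping.lookup (mat_exponent A m) i)"
      by (rule prod.mono_neutral_left)
        (use keys_mat_exponent[of A m] dims in \<open>auto simp: in_keys_iff\<close>)
    also have "\<dots> = (\<Prod>i<l. \<Prod>j<k. z i powi (A $$ (i, j) * Poly_Mapping.lookup m j))"
      by (rule prod.cong) (auto simp: lookup_mat_exponent dims powi_sum z)
    also have "\<dots> = (\<Prod>j<k. \<Prod>i<l. z i powi (A $$ (i, j) * Poly_Mapping.lookup m j))"
      by (rule prod.swap)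
    also have "\<dots> = (\<Prod>j<k. monomial_tuple z A j powi Poly_Mapping.lookup m j)"
      by (simp add: monomial_tuple_def dims powi_prod power_int_mult)
    also have "\<dots> = (\<Prod>j \<in> Poly_Mapping.keys m. monomial_tuple z A j powi Poly_Mapping.lookup m j)"
      by (rule prod.mono_neutral_right) (use km in \<open>auto simp: in_keys_iff\<close>)
    finally show ?thesis .
  qed
  then show ?thesis
    by (simp add: laurent_subst_def laurent_eval_sum laurent_eval_single
        laurent_eval_def[of F])
qed

lemma mahler_measure_0: "mahler_measure 0 (Poly_Mapping.single 0 c) = ln (cmod c)"
  by (simp add: mahler_measure_def laurent_eval_single PiM_empty
      lebesgue_integral_count_space_finite)

end

theory Submission
  imports Defs "HOL-Probability.Probability" "HOL-Library.Function_Algebras"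
    "HOL-Complex_Analysis.Great_Picard"
begin

text \<open>
  Call \<open>R\<^sub>n\<close> convergent to \<open>A\<close> if for every \<open>m \<in> \<int>\<^sup>k\<close> the relations \<open>R\<^sub>n m = 0\<close> and \<open>A m = 0\<close> are
  equivalent for all large \<open>n\<close>. Every sequence of integer row vectors \<open>r\<^sub>n\<close> has a subsequence
  converging to some matrix \<open>A\<close>: a diagonal subsequence decides every relation, the relations that
  hold eventually span a finite-dimensional space, hence hold from a common index \<open>N\<close> on, and
  finitely many of the \<open>r\<^sub>n\<close> with \<open>n \<ge> N\<close> span the others and serve as the rows of \<open>A\<close>.
  Conversely the rows \<open>(1, n, n\<^sup>2, \<dots>) A\<close> converge to \<open>A\<close>. So it suffices that \<open>r\<^sub>n \<rightarrow> A\<close> implies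
  convergence of the Mahler measures. All moments of \<open>\<bar>F\<^sub>r\<bar>\<^sup>2\<close> are constant terms of Laurent
  polynomials and thus eventually equal those of \<open>\<bar>F\<^sub>A\<bar>\<^sup>2\<close>, so the expectations of continuous
  functions converge by Weierstrass approximation. For the logarithm one needs in addition that
  \<open>\<bar>F\<^sub>r\<bar> \<le> x\<close> has measure at most \<open>C x\<^sup>a\<close> with \<open>C\<close> and \<open>a\<close> independent of \<open>r\<close>.
\<close>

section \<open>Convergence of logarithmic expectations from moments\<close>

text \<open>The deficit \<open>max 0 (- N - ln X)\<close> is at most the number of \<open>j\<close>
  with \<open>X \<le> exp (- (N + j))\<close>. Integrating this count turns the tail bound into a
  geometric series of ratio \<open>exp (- a)\<close>.\<close>

lemma (in prob_space) ln_truncation_error: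
  fixes X :: "'a \<Rightarrow> real"
  assumes X [measurable]: "X \<in> borel_measurable M"
    and bd: "\<And>w. w \<in> space M \<Longrightarrow> X w \<in> {0..K}"
    and a: "a > 0" and C: "C \<ge> 0"
    and tail: "\<And>x. x > 0 \<Longrightarrow> prob {w \<in> space M. X w \<le> x} \<le> C * x powr a"
  shows "\<bar>expectation (\<lambda>w. ln (X w)) - expectation (\<lambda>w. ln (max (X w) (exp (- real N))))\<bar>
        \<le> C * exp (- a) ^ N / (1 - exp (- a))"
proof -
  define q where "q = exp (- a)"
  have q: "0 < q" "q < 1" using a by (auto simp: q_def)
  \<comment> \<open>Letting x tend to 0 in the tail bound shows that the value 0 has probability 0,
    so the convention \<open>ln 0 = 0\<close> does not affect the integral.\<close>
  have pos: "AE w in M. X w > 0"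
  proof -
    have le: "prob {w \<in> space M. X w \<le> 0} \<le> C * x powr a" if "x > 0" for x
    proof -
      have "prob {w \<in> space M. X w \<le> 0} \<le> prob {w \<in> space M. X w \<le> x}"
        by (rule finite_measure_mono) (use that in auto)
      then show ?thesis using tail[OF that] by linarith
    qed
    have "((\<lambda>x. C * x powr a) \<longlongrightarrow> C * 0) (at_right 0)"
      using a by (intro tendsto_intros tendsto_zero_powrI[OF tendsto_ident_at]) (auto simp: eventually_at_filter)
    then have "((\<lambda>x. C * x powr a) \<longlongrightarrow> 0) (at_right 0)" by simp
    moreover have "\<forall>\<^sub>F x in at_right 0. prob {w \<in> space M. X w \<le> 0} \<le> C * x powr a"
      using le by (auto simp: eventually_at_right_less eventually_at_filter)
    ultimately have "prob {w \<in> space M. X w \<le> 0} \<le> 0"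
      by (rule tendsto_lowerbound) simp
    then have "prob {w \<in> space M. X w \<le> 0} = 0"
      by (simp add: measure_le_0_iff)
    then have "AE w in M. \<not> X w \<le> 0"
      by (subst (asm) prob_eq_0) auto
    then show ?thesis by eventually_elim auto
  qed
  have "\<bar>expectation (\<lambda>w. ln (X w)) - expectation (\<lambda>w. ln (max (X w) (exp (- real N))))\<bar>
        \<le> C * q ^ N / (1 - q)"
  proof -
    define D where "D = (\<lambda>w. max 0 (- real N - ln (X w)))"
    have D [measurable]: "D \<in> borel_measurable M" by (simp add: D_def)
    have pw: "ennreal (D w) \<le> (suminf (\<lambda>j. indicator {w \<in> space M. X w \<le> exp (- real (N + j))} w))"
      if w: "w \<in> space M" "X w > 0" for w
    proof -
      define n where "n = nat (\<lceil>D w\<rceil>)"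
      have "D w \<le> real n" unfolding n_def by (rule real_nat_ceiling_ge)
      then have "ennreal (D w) \<le> ennreal (real n)" by (rule ennreal_leI)
      also have "\<dots> = (\<Sum>j<n. (1::ennreal))"
        by (simp add: ennreal_of_nat_eq_real_of_nat)
      also have "\<dots> \<le> (\<Sum>j<n. indicator {w \<in> space M. X w \<le> exp (- real (N + j))} w)"
      proof (rule sum_mono)
        fix j assume "j \<in> {..<n}"
        then have "real j < D w" unfolding n_def by (simp add: lessThan_iff) linarith
        then have "ln (X w) \<le> - real (N + j)" by (auto simp: D_def max_def split: if_splits)
        then have "X w \<le> exp (- real (N + j))" using w by (metis exp_le_cancel_iff exp_ln)
        then show "1 \<le> (indicator {w \<in> space M. X w \<le> exp (- real (N + j))} w :: ennreal)"
          using w by simp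
      qed
      also have "\<dots> \<le> (suminf (\<lambda>j. indicator {w \<in> space M. X w \<le> exp (- real (N + j))} w))"
        by (rule sum_le_suminf) auto
      finally show ?thesis .
    qed
    have "(\<integral>\<^sup>+w. ennreal (D w) \<partial>M) \<le>
        (\<integral>\<^sup>+w. (suminf (\<lambda>j. indicator {w \<in> space M. X w \<le> exp (- real (N + j))} w)) \<partial>M)"
    proof (rule nn_integral_mono_AE)
      show "AE w in M. ennreal (D w) \<le> (suminf (\<lambda>j. indicator {w \<in> space M. X w \<le> exp (- real (N + j))} w))"
        using pos AE_space by eventually_elim (rule pw)
    qed
    also have "\<dots> = (suminf (\<lambda>j. emeasure M {w \<in> space M. X w \<le> exp (- real (N + j))}))"
      by (subst nn_integral_suminf) auto
    also have "\<dots> \<le> (suminf (\<lambda>j. ennreal (C * q ^ N * q ^ j)))"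
    proof (rule suminf_le)
      fix j
      have "prob {w \<in> space M. X w \<le> exp (- real (N + j))} \<le> C * exp (- real (N + j)) powr a"
        by (rule tail) simp
      also have "exp (- real (N + j)) powr a = q ^ N * q ^ j"
        by (simp add: powr_def q_def algebra_simps flip: exp_add exp_of_nat_mult)
      finally show "emeasure M {w \<in> space M. X w \<le> exp (- real (N + j))}
         \<le> ennreal (C * q ^ N * q ^ j)"
        by (simp add: emeasure_eq_measure ennreal_leI mult.assoc)
    qed auto
    also have "\<dots> = ennreal (suminf (\<lambda>j. C * q ^ N * q ^ j))"
      using C q by (intro suminf_ennreal2) (auto intro!: summable_mult)
    also have "(suminf (\<lambda>j. C * q ^ N * q ^ j)) = C * q ^ N / (1 - q)"
      using q by (subst suminf_mult) (auto simp: suminf_geometric)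
    finally have nn: "(\<integral>\<^sup>+w. ennreal (D w) \<partial>M) \<le> ennreal (C * q ^ N / (1 - q))" .
    have Dnn: "D w \<ge> 0" for w by (simp add: D_def)
    have intD: "integrable M D"
      by (rule integrableI_nonneg) (use nn Dnn in \<open>auto intro: le_less_trans\<close>)
    have ED: "expectation D \<le> C * q ^ N / (1 - q)"
    proof -
      have "ennreal (expectation D) \<le> ennreal (C * q ^ N / (1 - q))"
        using nn_integral_eq_integral[OF intD] nn Dnn by simp
      then show ?thesis
        by (subst (asm) ennreal_le_iff) (use C q in auto)
    qed
    have intm: "integrable M (\<lambda>w. ln (max (X w) (exp (- real N))))"
    proof (rule integrable_const_bound)
      show "AE w in M. norm (ln (max (X w) (exp (- real N)))) \<le> real N + \<bar>ln (max K (exp (- real N)))\<bar>"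
      proof (rule AE_I2)
        fix w assume "w \<in> space M"
        then have "max (X w) (exp (- real N)) \<le> max K (exp (- real N))" using bd by fastforce
        then have "ln (max (X w) (exp (- real N))) \<le> ln (max K (exp (- real N)))"
          by (subst ln_le_cancel_iff) (auto simp: less_max_iff_disj)
        moreover have "ln (exp (- real N)) \<le> ln (max (X w) (exp (- real N)))"
          by (subst ln_le_cancel_iff) (auto simp: less_max_iff_disj)
        ultimately show "norm (ln (max (X w) (exp (- real N)))) \<le> real N + \<bar>ln (max K (exp (- real N)))\<bar>"
          by simp
      qed
    qed simp
    have eq: "AE w in M. ln (X w) = ln (max (X w) (exp (- real N))) - D w"
      using pos
    proof eventually_elim
      case (elim w)
      show ?case
      proof (cases "X w \<le> exp (- real N)")
        case True
        then have "ln (X w) \<le> - real N" using elim by (metis exp_le_cancel_iff exp_ln)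
        then show ?thesis using True by (simp add: D_def max_def)
      next
        case False
        then have "ln (X w) > - real N" using elim by (metis exp_less_cancel_iff exp_ln not_le)
        then show ?thesis using False by (simp add: D_def max_def)
      qed
    qed
    have "expectation (\<lambda>w. ln (X w)) = expectation (\<lambda>w. ln (max (X w) (exp (- real N))) - D w)"
      by (rule integral_cong_AE) (use eq in auto)
    also have "\<dots> = expectation (\<lambda>w. ln (max (X w) (exp (- real N)))) - expectation D"
      using intm intD by simp
    finally show ?thesis using ED Bochner_Integration.integral_nonneg[of M D] Dnn by auto
  qed
  then show ?thesis by (simp add: q_def)
qed

text \<open>Convergence of moments gives convergence for polynomials, and on the compact interval
  \<open>{0..K}\<close> a polynomial approximates \<open>g\<close> uniformly within
  \<open>e / 3\<close>.\<close>

lemma tendsto_expectation_of_moments: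
  fixes X :: "nat \<Rightarrow> 'a \<Rightarrow> real" and Y :: "'b \<Rightarrow> real" and g :: "real \<Rightarrow> real"
  assumes P: "prob_space P" and Q: "prob_space Q"
    and X: "\<And>n. X n \<in> borel_measurable P" and Y: "Y \<in> borel_measurable Q"
    and bX: "\<And>n w. w \<in> space P \<Longrightarrow> X n w \<in> {0..K}" and bY: "\<And>w. w \<in> space Q \<Longrightarrow> Y w \<in> {0..K}"
    and mom: "\<And>j. (\<lambda>n. \<integral>w. X n w ^ j \<partial>P) \<longlonglongrightarrow> (\<integral>w. Y w ^ j \<partial>Q)"
    and g: "continuous_on UNIV g"
  shows "(\<lambda>n. \<integral>w. g (X n w) \<partial>P) \<longlonglongrightarrow> (\<integral>w. g (Y w) \<partial>Q)"
proof (rule LIMSEQ_I)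
  fix e :: real assume e: "e > 0"
  interpret P: prob_space P by fact
  interpret Q: prob_space Q by fact
  have gm [measurable]: "g \<in> borel_measurable borel"
    using g by (rule borel_measurable_continuous_onI)
  note [measurable] = X Y
  obtain h where h: "real_polynomial_function h" "\<And>x. x \<in> {0..K} \<Longrightarrow> \<bar>g x - h x\<bar> < e / 3"
    by (rule Stone_Weierstrass_real_polynomial_function[of "{0..K}" g "e/3"])
       (use e g in \<open>auto intro: continuous_on_subset\<close>)
  obtain c N where hc: "h = (\<lambda>x. \<Sum>i\<le>N. c i * x ^ i)"
    using h(1) by (auto simp: real_polynomial_function_iff_sum)
  have hm [measurable]: "h \<in> borel_measurable borel" by (simp add: hc)
  have bdg: "\<exists>B. \<forall>x\<in>{0..K}. \<bar>f x\<bar> \<le> B" if "continuous_on UNIV f" for f :: "real \<Rightarrow> real"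
  proof -
    have "bounded (f ` {0..K})"
      by (intro compact_imp_bounded compact_continuous_image continuous_on_subset[OF that]) auto
    then show ?thesis by (auto simp: bounded_iff)
  qed
  have iX: "integrable P (\<lambda>w. f (X n w))" if f: "continuous_on UNIV f" for f :: "real \<Rightarrow> real" and n
  proof -
    obtain B where "\<forall>x\<in>{0..K}. \<bar>f x\<bar> \<le> B" using bdg[OF f] by blast
    then show ?thesis using bX borel_measurable_continuous_onI[OF f]
      by (intro P.integrable_const_bound[of _ B]) auto
  qed
  have iY: "integrable Q (\<lambda>w. f (Y w))" if f: "continuous_on UNIV f" for f :: "real \<Rightarrow> real"
  proof -
    obtain B where "\<forall>x\<in>{0..K}. \<bar>f x\<bar> \<le> B" using bdg[OF f] by blast
    then show ?thesis using bY borel_measurable_continuous_onI[OF f]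
      by (intro Q.integrable_const_bound[of _ B]) auto
  qed
  have ch: "continuous_on UNIV h" unfolding hc by (intro continuous_intros)
  have ip: "continuous_on UNIV (\<lambda>x::real. x ^ i)" for i by (intro continuous_intros)
  have "(\<lambda>n. \<Sum>i\<le>N. c i * (\<integral>w. X n w ^ i \<partial>P)) \<longlonglongrightarrow> (\<Sum>i\<le>N. c i * (\<integral>w. Y w ^ i \<partial>Q))"
    by (intro tendsto_intros mom)
  moreover have "(\<Sum>i\<le>N. c i * (\<integral>w. X n w ^ i \<partial>P)) = (\<integral>w. h (X n w) \<partial>P)" for n
    unfolding hc using iX[OF ip] by simp
  moreover have "(\<Sum>i\<le>N. c i * (\<integral>w. Y w ^ i \<partial>Q)) = (\<integral>w. h (Y w) \<partial>Q)"
    unfolding hc using iY[OF ip] by simp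
  ultimately have "(\<lambda>n. \<integral>w. h (X n w) \<partial>P) \<longlonglongrightarrow> (\<integral>w. h (Y w) \<partial>Q)" by simp
  then obtain n0 where n0: "\<And>n. n \<ge> n0 \<Longrightarrow> norm ((\<integral>w. h (X n w) \<partial>P) - (\<integral>w. h (Y w) \<partial>Q)) < e / 3"
    using e by (meson LIMSEQ_D divide_pos_pos zero_less_numeral)
  have dX: "\<bar>(\<integral>w. g (X n w) \<partial>P) - (\<integral>w. h (X n w) \<partial>P)\<bar> \<le> e / 3" for n
  proof -
    have "\<bar>\<integral>w. g (X n w) - h (X n w) \<partial>P\<bar> \<le> (\<integral>w. \<bar>g (X n w) - h (X n w)\<bar> \<partial>P)" by simp
    also have "\<dots> \<le> (\<integral>w. e / 3 \<partial>P)"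
      by (intro integral_mono integrable_abs Bochner_Integration.integrable_diff iX[OF g] iX[OF ch]) (use h(2) bX in \<open>auto intro: less_imp_le\<close>)
    finally show ?thesis using iX[OF g] iX[OF ch] by (simp add: P.prob_space)
  qed
  have dY: "\<bar>(\<integral>w. g (Y w) \<partial>Q) - (\<integral>w. h (Y w) \<partial>Q)\<bar> \<le> e / 3"
  proof -
    have "\<bar>\<integral>w. g (Y w) - h (Y w) \<partial>Q\<bar> \<le> (\<integral>w. \<bar>g (Y w) - h (Y w)\<bar> \<partial>Q)" by simp
    also have "\<dots> \<le> (\<integral>w. e / 3 \<partial>Q)"
      by (intro integral_mono integrable_abs Bochner_Integration.integrable_diff iY[OF g] iY[OF ch]) (use h(2) bY in \<open>auto intro: less_imp_le\<close>)
    finally show ?thesis using iY[OF g] iY[OF ch] by (simp add: Q.prob_space)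
  qed
  show "\<exists>no. \<forall>n\<ge>no. norm ((\<integral>w. g (X n w) \<partial>P) - (\<integral>w. g (Y w) \<partial>Q)) < e"
  proof (intro exI allI impI)
    fix n assume "n \<ge> n0"
    then show "norm ((\<integral>w. g (X n w) \<partial>P) - (\<integral>w. g (Y w) \<partial>Q)) < e"
      using dX[of n] dY n0[of n] unfolding real_norm_def by linarith
  qed
qed

text \<open>The truncated logarithm \<open>ln (max x (exp (- N)))\<close> is continuous, so its
  expectations converge for each \<open>N\<close>. The tail bound makes the truncation error small
  uniformly in \<open>n\<close>, which permits the exchange of limits.\<close>

lemma tendsto_expectation_ln_of_moments:
  fixes X :: "nat \<Rightarrow> 'a \<Rightarrow> real" and Y :: "'b \<Rightarrow> real"
  assumes P: "prob_space P" and Q: "prob_space Q"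
    and X: "\<And>n. X n \<in> borel_measurable P" and Y: "Y \<in> borel_measurable Q"
    and bX: "\<And>n w. w \<in> space P \<Longrightarrow> X n w \<in> {0..K}" and bY: "\<And>w. w \<in> space Q \<Longrightarrow> Y w \<in> {0..K}"
    and mom: "\<And>j. (\<lambda>n. \<integral>w. X n w ^ j \<partial>P) \<longlonglongrightarrow> (\<integral>w. Y w ^ j \<partial>Q)"
    and a: "a > 0" and C: "C \<ge> 0"
    and tail: "\<And>n x. x > 0 \<Longrightarrow> measure P {w \<in> space P. X n w \<le> x} \<le> C * x powr a"
  shows "(\<lambda>n. \<integral>w. ln (X n w) \<partial>P) \<longlonglongrightarrow> (\<integral>w. ln (Y w) \<partial>Q)"
proof -
  interpret P: prob_space P by fact
  interpret Q: prob_space Q by fact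
  note [measurable] = X Y
  have conv: "(\<lambda>n. \<integral>w. g (X n w) \<partial>P) \<longlonglongrightarrow> (\<integral>w. g (Y w) \<partial>Q)"
    if "continuous_on UNIV g" for g :: "real \<Rightarrow> real"
    using P Q X Y bX bY mom that by (rule tendsto_expectation_of_moments)
  \<comment> \<open>The tail bound is assumed for the \<open>X n\<close> only. It passes to
    \<open>Y\<close> through a continuous cutoff that is 1 up to \<open>x\<close> and 0 from
    \<open>2 * x\<close> on; the doubled threshold costs the factor \<open>2 powr a\<close>.\<close>
  define C' where "C' = C * 2 powr a"
  have C': "C' \<ge> C" "C' \<ge> 0" using a C by (auto simp: C'_def mult_le_cancel_left1 ge_one_powr_ge_zero)
  have tailY: "measure Q {w \<in> space Q. Y w \<le> x} \<le> C' * x powr a" if x: "x > 0" for x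
  proof -
    define g where "g = (\<lambda>y::real. max 0 (min 1 (2 - y / x)))"
    have g: "continuous_on UNIV g" unfolding g_def by (intro continuous_intros) (use x in auto)
    have gm [measurable]: "g \<in> borel_measurable borel" using g by (rule borel_measurable_continuous_onI)
    have g01: "0 \<le> g y" "g y \<le> 1" for y by (auto simp: g_def)
    have "measure Q {w \<in> space Q. Y w \<le> x} = (\<integral>w. indicator {w \<in> space Q. Y w \<le> x} w \<partial>Q)"
      by simp
    also have "\<dots> \<le> (\<integral>w. g (Y w) \<partial>Q)"
    proof (rule integral_mono)
      show "integrable Q (\<lambda>w. g (Y w))"
        by (rule Q.integrable_const_bound[of _ 1]) (use g01 in auto)
      show "indicator {w \<in> space Q. Y w \<le> x} w \<le> g (Y w)" for w
        using x g01 by (auto simp: indicator_def g_def field_simps)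
    qed (auto simp: Q.emeasure_eq_measure)
    also have "\<dots> \<le> C' * x powr a"
    proof (rule tendsto_upperbound[OF conv[OF g]])
      show "\<forall>\<^sub>F n in sequentially. (\<integral>w. g (X n w) \<partial>P) \<le> C' * x powr a"
      proof (rule always_eventually, rule allI)
        fix n
        have "(\<integral>w. g (X n w) \<partial>P) \<le> (\<integral>w. indicator {w \<in> space P. X n w \<le> 2 * x} w \<partial>P)"
        proof (rule integral_mono)
          show "integrable P (\<lambda>w. g (X n w))"
            by (rule P.integrable_const_bound[of _ 1]) (use g01 in auto)
          show "g (X n w) \<le> indicator {w \<in> space P. X n w \<le> 2 * x} w" if "w \<in> space P" for w
            using x that by (auto simp: indicator_def g_def field_simps)
        qed (auto simp: P.emeasure_eq_measure)
        also have "\<dots> = measure P {w \<in> space P. X n w \<le> 2 * x}" by simp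
        also have "\<dots> \<le> C * (2 * x) powr a" by (rule tail) (use x in auto)
        also have "\<dots> = C' * x powr a" using x by (simp add: C'_def powr_mult)
        finally show "(\<integral>w. g (X n w) \<partial>P) \<le> C' * x powr a" .
      qed
    qed simp
    finally show ?thesis .
  qed
  have tailX: "measure P {w \<in> space P. X n w \<le> x} \<le> C' * x powr a" if x: "x > 0" for n x
  proof -
    have "C * x powr a \<le> C' * x powr a" using C' by (intro mult_right_mono) auto
    then show ?thesis using tail[OF x, of n] by linarith
  qed
  define err where "err = (\<lambda>N. C' * exp (- a) ^ N / (1 - exp (- a)))"
  have eX: "\<bar>(\<integral>w. ln (X n w) \<partial>P) - (\<integral>w. ln (max (X n w) (exp (- real N))) \<partial>P)\<bar> \<le> err N" for n N
    unfolding err_def by (rule P.ln_truncation_error[where K = K]) (use X bX a C' tailX in auto)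
  have eY: "\<bar>(\<integral>w. ln (Y w) \<partial>Q) - (\<integral>w. ln (max (Y w) (exp (- real N))) \<partial>Q)\<bar> \<le> err N" for N
    unfolding err_def by (rule Q.ln_truncation_error[where K = K]) (use Y bY a C' tailY in auto)
  have "(\<lambda>N. C' * exp (- a) ^ N / (1 - exp (- a))) \<longlonglongrightarrow> C' * 0 / (1 - exp (- a))"
    using a by (intro tendsto_intros LIMSEQ_realpow_zero) auto
  then have err0: "err \<longlonglongrightarrow> 0" by (simp add: err_def)
  show ?thesis
  proof (rule LIMSEQ_I)
    fix e :: real assume e: "e > 0"
    obtain N where N: "norm (err N - 0) < e / 3"
      using LIMSEQ_D[OF err0, of "e/3"] e by auto
    have "(\<lambda>n. \<integral>w. ln (max (X n w) (exp (- real N))) \<partial>P) \<longlonglongrightarrow> (\<integral>w. ln (max (Y w) (exp (- real N))) \<partial>Q)"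
    proof (rule conv)
      have "max x (exp (- real N)) \<noteq> 0" for x
        by (metis exp_gt_zero less_irrefl less_max_iff_disj)
      then show "continuous_on UNIV (\<lambda>x. ln (max x (exp (- real N))))"
        by (intro continuous_intros) auto
    qed
    then obtain n0 where n0: "\<And>n. n \<ge> n0 \<Longrightarrow> norm ((\<integral>w. ln (max (X n w) (exp (- real N))) \<partial>P) - (\<integral>w. ln (max (Y w) (exp (- real N))) \<partial>Q)) < e / 3"
      using e by (meson LIMSEQ_D divide_pos_pos zero_less_numeral)
    show "\<exists>no. \<forall>n\<ge>no. norm ((\<integral>w. ln (X n w) \<partial>P) - (\<integral>w. ln (Y w) \<partial>Q)) < e"
    proof (intro exI allI impI)
      fix n assume "n \<ge> n0"
      then show "norm ((\<integral>w. ln (X n w) \<partial>P) - (\<integral>w. ln (Y w) \<partial>Q)) < e"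
        using eX[of n N] eY[of N] n0[of n] N unfolding real_norm_def by linarith
    qed
  qed
qed

section \<open>Small values of trigonometric sums\<close>

text \<open>The left side of the chord formula is twice the modulus of sin (pi v), and sin y \<ge> y
  / 2 on the interval from 0 to pi / 2.\<close>

lemma norm_cis_minus_one_ge:
  fixes v :: real
  assumes "\<bar>v\<bar> \<le> 1 / 2"
  shows "2 * \<bar>v\<bar> \<le> cmod (cis (2 * pi * v) - 1)"
proof -
  define y where "y = pi * \<bar>v\<bar>"
  have y: "0 \<le> y" "y \<le> pi / 2" using assms by (auto simp: y_def)
  have pi: "pi < 3.2" using pi_approx by simp
  \<comment> \<open>The cubic Taylor error y^3 / 6 is then at most (2.56 / 6) y, which is below y /
    2.\<close>
  have "y \<le> 1.6" using y pi by simp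
  then have "y * y \<le> 1.6 * 1.6" using y by (intro mult_mono) auto
  then have "y * (y * y) \<le> y * (1.6 * 1.6)" using y by (intro mult_left_mono) auto
  moreover have "\<bar>sin y - (\<Sum>m<3. sin_coeff m * y ^ m)\<bar> \<le> inverse (fact 3) * \<bar>y\<bar> ^ 3"
    by (rule Maclaurin_sin_bound)
  then have "\<bar>sin y - y\<bar> \<le> y ^ 3 / 6"
    using y by (simp add: sin_coeff_def numeral_eq_Suc divide_simps)
  ultimately have "\<bar>sin y - y\<bar> \<le> y * (1.6 * 1.6) / 6" by (simp add: power3_eq_cube mult.assoc)
  then have "sin y \<ge> y / 2" using y by linarith
  moreover have "cmod (cis (2 * pi * v) - 1) = 2 * \<bar>sin (pi * v)\<bar>"
    using dist_exp_i_1[of "2 * pi * v"] by (simp add: cis_conv_exp)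
  moreover have "\<bar>sin (pi * v)\<bar> = \<bar>sin y\<bar>" by (cases "v \<ge> 0") (auto simp: y_def)
  moreover have "2 * \<bar>v\<bar> \<le> y" unfolding y_def using pi_ge_two by (intro mult_right_mono) auto
  ultimately show ?thesis by linarith
qed

text \<open>Such an \<open>s\<close> lies close to a fraction \<open>i / j\<close> with
  \<open>\<bar>i\<bar> \<le> \<bar>j\<bar>\<close>. There are \<open>2 * \<bar>j\<bar> + 1\<close>
  of these, each with an interval of length \<open>z / \<bar>j\<bar>\<close>, so the total is at
  most \<open>3 * z\<close> whatever the size of \<open>j\<close>.\<close>

lemma emeasure_cis_near_one:
  fixes j :: int
  assumes "j \<noteq> 0" "z > 0"
  shows "emeasure lborel {s\<in>{-1..1}. cmod (cis (2 * pi * (of_int j * s)) - 1) < z} \<le> ennreal (3 * z)"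
proof -
  let ?B = "{s\<in>{-1..1}. cmod (cis (2 * pi * (of_int j * s)) - 1) < z}"
  define w where "w = z / (2 * \<bar>real_of_int j\<bar>)"
  have w: "w > 0" using assms by (simp add: w_def)
  let ?U = "\<lambda>i::int. {of_int i / of_int j - w .. of_int i / of_int j + w}"
  have "?B \<subseteq> (\<Union>i\<in>{-\<bar>j\<bar>..\<bar>j\<bar>}. ?U i)"
  proof
    fix s assume s: "s \<in> ?B"
    define u where "u = of_int j * s"
    define i where "i = round u"
    have ui: "\<bar>u - of_int i\<bar> \<le> 1 / 2" unfolding i_def using of_int_round_abs_le[of u] by (simp add: abs_minus_commute)
    have "\<bar>u\<bar> \<le> \<bar>of_int j\<bar>"
      using s by (auto simp: u_def abs_mult intro!: mult_left_le)
    then have "\<bar>of_int i\<bar> \<le> real_of_int \<bar>j\<bar> + 1/2" using ui by linarith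
    then have i: "\<bar>i\<bar> \<le> \<bar>j\<bar>" by linarith
    have "cis (2 * pi * u) = cis (2 * pi * (u - of_int i))"
      by (simp add: cis_divide right_diff_distrib cis_multiple_2pi flip: cis_divide)
    then have "2 * \<bar>u - of_int i\<bar> < z"
      using norm_cis_minus_one_ge[OF ui] s by (simp add: u_def)
    then have "\<bar>of_int j * (s - of_int i / of_int j)\<bar> < z / 2"
      using assms by (simp add: u_def right_diff_distrib)
    then have "\<bar>of_int j\<bar> * \<bar>s - of_int i / of_int j\<bar> < z / 2"
      by (simp only: abs_mult)
    then have "\<bar>s - of_int i / of_int j\<bar> < w"
      using assms by (simp add: w_def field_simps)
    then have "s \<in> ?U i" by (auto simp: abs_if split: if_splits)
    then show "s \<in> (\<Union>i\<in>{-\<bar>j\<bar>..\<bar>j\<bar>}. ?U i)" using i by (intro UN_I[of i]) auto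
  qed
  then have "emeasure lborel ?B \<le> emeasure lborel (\<Union>i\<in>{-\<bar>j\<bar>..\<bar>j\<bar>}. ?U i)"
    by (rule emeasure_mono) auto
  also have "\<dots> \<le> (\<Sum>i\<in>{-\<bar>j\<bar>..\<bar>j\<bar>}. emeasure lborel (?U i))"
    by (rule emeasure_subadditive_finite) auto
  also have "\<dots> = (\<Sum>i\<in>{-\<bar>j\<bar>..\<bar>j\<bar>}. ennreal (2 * w))"
    using w by (intro sum.cong) auto
  also have "\<dots> = ennreal (\<Sum>i\<in>{-\<bar>j\<bar>..\<bar>j\<bar>}. 2 * w)"
    using w by (subst sum_ennreal) auto
  also have "\<dots> \<le> ennreal (3 * z)"
  proof (rule ennreal_leI)
    have "(\<Sum>i\<in>{-\<bar>j\<bar>..\<bar>j\<bar>}. 2 * w) = (2 * \<bar>real_of_int j\<bar> + 1) * (2 * w)" by simp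
    also have "\<dots> \<le> (3 * \<bar>real_of_int j\<bar>) * (2 * w)"
      using w assms by (intro mult_right_mono) auto
    also have "\<dots> = 3 * z" using assms by (simp add: w_def)
    finally show "(\<Sum>i\<in>{-\<bar>j\<bar>..\<bar>j\<bar>}. 2 * w) \<le> 3 * z" .
  qed
  finally show ?thesis .
qed

text \<open>By Tonelli and translation invariance the square is the integral over all
  \<open>s\<close> of the measure of the overlap of \<open>E\<close> with its translate. Overlaps
  are empty unless \<open>s\<close> lies in \<open>{-1..1}\<close>.\<close>

lemma emeasure_square_le_translates:
  fixes E :: "real set"
  assumes E [measurable]: "E \<in> sets borel" and sub: "E \<subseteq> {0..1}"
  shows "emeasure lborel E * emeasure lborel E
    \<le> (\<integral>\<^sup>+s. indicator {-1..1} s * emeasure lborel {t. t \<in> E \<and> t + s \<in> E} \<partial>lborel)"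
proof -
  have tr: "emeasure lborel E = (\<integral>\<^sup>+s. indicator E (t + s) \<partial>lborel)" for t
    using nn_integral_real_affine[of "indicator E" 1 t] by simp
  have "emeasure lborel E * emeasure lborel E = (\<integral>\<^sup>+t. indicator E t * emeasure lborel E \<partial>lborel)"
    by (simp add: nn_integral_multc)
  also have "\<dots> = (\<integral>\<^sup>+t. (\<integral>\<^sup>+s. indicator E t * indicator E (t + s) \<partial>lborel) \<partial>lborel)"
    by (subst nn_integral_cmult) (auto simp flip: tr)
  also have "\<dots> = (\<integral>\<^sup>+s. (\<integral>\<^sup>+t. indicator E t * indicator E (t + s) \<partial>lborel) \<partial>lborel)"
    by (rule lborel_pair.Fubini'[symmetric]) (auto simp: split_beta')
  also have "\<dots> \<le> (\<integral>\<^sup>+s. indicator {-1..1} s * emeasure lborel {t. t \<in> E \<and> t + s \<in> E} \<partial>lborel)"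
  proof (rule nn_integral_mono)
    fix s :: real
    have "(\<integral>\<^sup>+t. indicator E t * indicator E (t + s) \<partial>lborel)
        = (\<integral>\<^sup>+t. indicator {t. t \<in> E \<and> t + s \<in> E} t \<partial>lborel)"
      by (rule nn_integral_cong) (auto simp: indicator_def)
    also have "\<dots> = emeasure lborel {t. t \<in> E \<and> t + s \<in> E}" by simp
    also have "\<dots> = indicator {-1..1} s * emeasure lborel {t. t \<in> E \<and> t + s \<in> E}"
    proof (cases "s \<in> {-1..1}")
      case False
      then have "t + s \<notin> {0..1}" if "t \<in> {0..1}" for t using that by auto
      then have "{t. t \<in> E \<and> t + s \<in> E} = {}" using sub by blast
      then show ?thesis using False by (simp only: emeasure_empty mult_zero_right)
    qed simp
    finally show "(\<integral>\<^sup>+t. indicator E t * indicator E (t + s) \<partial>lborel)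
      \<le> indicator {-1..1} s * emeasure lborel {t. t \<in> E \<and> t + s \<in> E}" by simp
  qed
  finally show ?thesis .
qed


section \<open>Trigonometric sums in one variable with a bounded number of terms\<close>

definition trig_sum :: "int set \<Rightarrow> (int \<Rightarrow> complex) \<Rightarrow> real \<Rightarrow> complex" where
  "trig_sum J b t = (\<Sum>j\<in>J. b j * cis (2 * pi * (of_int j * t)))"

lemma trig_sum_measurable [measurable]: "trig_sum J b \<in> borel_measurable borel"
proof -
  have "continuous_on UNIV (trig_sum J b)"
    unfolding trig_sum_def by (intro continuous_intros)
  then show ?thesis by (rule borel_measurable_continuous_onI)
qed

text \<open>The factor in front of the translated sum cancels the phase acquired by frequency
  \<open>i\<close>, so the terms of that frequency drop out of the difference.\<close>

lemma trig_sum_translate: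
  assumes "finite J" "i \<in> J"
  shows "cis (- (2 * pi * (of_int i * s))) * trig_sum J b (t + s) - trig_sum J b t
    = trig_sum (J - {i}) (\<lambda>j. b j * (cis (2 * pi * (of_int (j - i) * s)) - 1)) t"
proof -
  have "cis (- (2 * pi * (of_int i * s))) * trig_sum J b (t + s) - trig_sum J b t
    = trig_sum J (\<lambda>j. b j * (cis (2 * pi * (of_int (j - i) * s)) - 1)) t"
    unfolding trig_sum_def sum_distrib_left sum_subtractf[symmetric]
  proof (rule sum.cong)
    fix j
    have "cis (- (2 * pi * (of_int i * s))) * cis (2 * pi * (of_int j * (t + s)))
       = cis (2 * pi * (of_int (j - i) * s)) * cis (2 * pi * (of_int j * t))"
      by (simp add: cis_mult algebra_simps)
    then show "cis (- (2 * pi * (of_int i * s))) * (b j * cis (2 * pi * (of_int j * (t + s))))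
        - b j * cis (2 * pi * (of_int j * t))
      = b j * (cis (2 * pi * (of_int (j - i) * s)) - 1) * cis (2 * pi * (of_int j * t))"
      by (simp add: algebra_simps)
  qed simp
  also have "\<dots> = trig_sum (J - {i}) (\<lambda>j. b j * (cis (2 * pi * (of_int (j - i) * s)) - 1)) t"
    unfolding trig_sum_def using assms by (subst sum.remove[of J i]) auto
  finally show ?thesis .
qed

text \<open>Only the number of frequencies is bounded, not their size: this is the source of
  uniformity over row vectors. Measuring the threshold in units of the coefficient bound
  \<open>c\<close> makes the statement scale invariant.\<close>

definition small_value_bound :: "nat \<Rightarrow> real \<Rightarrow> real \<Rightarrow> bool" where
  "small_value_bound N C a \<longleftrightarrow>
    (\<forall>J b c x. finite J \<and> card J \<le> N \<and> 0 < c \<and> 0 < x \<and> (\<exists>j\<in>J. c \<le> cmod (b j)) \<longrightarrow>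
      emeasure lborel {t\<in>{0..1}. cmod (trig_sum J b t) \<le> c * x} \<le> ennreal (C * x powr a))"

text \<open>
  The induction removes the frequency \<open>i\<close>: where the sum is small at both \<open>t\<close> and \<open>t + s\<close>,
  so is the difference \<open>e(-is) p(t + s) - p(t)\<close>, which has one term less, and its coefficients
  are large unless \<open>(j - i) s\<close> is close to an integer.
\<close>

lemma small_value_bound_step:
  assumes IH: "small_value_bound N C a" and C: "C \<ge> 1" and a: "0 < a" "a \<le> 1"
  shows "small_value_bound (Suc N) (4 + 4 * C) (a / 4)"
  unfolding small_value_bound_def
proof (intro allI impI, elim conjE bexE)
  fix J :: "int set" and b :: "int \<Rightarrow> complex" and j :: int and c x :: real
  assume J: "finite J" "card J \<le> Suc N" and c: "0 < c" and x: "0 < x" and j: "j \<in> J" "c \<le> cmod (b j)"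
  define E where "E = {t\<in>{0..1}. cmod (trig_sum J b t) \<le> c * x}"
  have Em [measurable]: "E \<in> sets borel" unfolding E_def by measurable
  have "emeasure lborel E \<le> emeasure lborel {0..1::real}"
    by (rule emeasure_mono) (auto simp: E_def)
  then have E1: "emeasure lborel E \<le> 1" by simp
  have "emeasure lborel E \<le> ennreal ((4 + 4 * C) * x powr (a / 4))"
  proof (cases "x \<ge> 1")
    case True
    have "1 * 1 \<le> (4 + 4 * C) * x powr (a / 4)"
      using True a C by (intro mult_mono ge_one_powr_ge_zero) auto
    then have "ennreal 1 \<le> ennreal ((4 + 4 * C) * x powr (a / 4))" by (intro ennreal_leI) simp
    with E1 show ?thesis unfolding ennreal_1 by (rule order_trans)
  next
    case x1: False
    show ?thesis
    \<comment> \<open>A single term has constant modulus at least \<open>c\<close>, which exceeds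
      \<open>c * x\<close> because x < 1.\<close>
    proof (cases "J = {j}")
      case True
      have "c * x < c" using c x1 by simp
      then have "E = {}" using j True by (auto simp: E_def trig_sum_def norm_mult)
      then show ?thesis by simp
    next
      case False
      then obtain i where i: "i \<in> J" "i \<noteq> j" using j by auto
      \<comment> \<open>This choice splits the new threshold \<open>2 * c * x\<close> as
        \<open>(c * z) * (2 * z)\<close>: coefficient bound \<open>c * z\<close> off the exceptional
        set \<open>B\<close>, and relative threshold \<open>2 * z\<close>, while \<open>B\<close>
        has measure at most \<open>3 * z\<close>.\<close>
      define z where "z = sqrt x"
      have z: "z > 0" "z < 1" "z * z = x" using x x1 by (auto simp: z_def)
      define B where "B = {s\<in>{-1..1}. cmod (cis (2 * pi * (of_int (j - i) * s)) - 1) < z}"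
      have "continuous_on UNIV (\<lambda>s. cis (2 * pi * (of_int (j - i) * s)))"
        by (intro continuous_intros)
      then have [measurable]: "(\<lambda>s. cis (2 * pi * (of_int (j - i) * s))) \<in> borel_measurable borel"
        by (rule borel_measurable_continuous_onI)
      have Bm [measurable]: "B \<in> sets borel" unfolding B_def by measurable
      have B: "emeasure lborel B \<le> ennreal (3 * z)"
        unfolding B_def by (rule emeasure_cis_near_one) (use i z in auto)
      define H where "H = C * (2 * z) powr a"
      have H: "H \<ge> 0" using C by (simp add: H_def)
      \<comment> \<open>On \<open>B\<close> the trivial bound 1 is used. Off \<open>B\<close> the
        induction hypothesis applies, since frequency \<open>j\<close> survives the removal of
        \<open>i\<close> with a coefficient of modulus at least \<open>c * z\<close>.\<close>
      have inner: "emeasure lborel {t. t \<in> E \<and> t + s \<in> E} \<le> indicator B s + ennreal H"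
        if s: "s \<in> {-1..1}" for s
      proof (cases "s \<in> B")
        case True
        have "emeasure lborel {t. t \<in> E \<and> t + s \<in> E} \<le> emeasure lborel E"
          by (rule emeasure_mono) auto
        also have "\<dots> \<le> indicator B s + ennreal H" using True E1 by (simp add: add_increasing2)
        finally show ?thesis .
      next
        case False
        define b' where "b' = (\<lambda>j. b j * (cis (2 * pi * (of_int (j - i) * s)) - 1))"
        have "z \<le> cmod (cis (2 * pi * (of_int (j - i) * s)) - 1)"
          using False s by (simp add: B_def)
        then have "c * z \<le> cmod (b' j)"
          unfolding b'_def norm_mult using j c z by (intro mult_mono) auto
        then have "\<exists>j\<in>J - {i}. c * z \<le> cmod (b' j)" using i j by blast
        then have "emeasure lborel {t\<in>{0..1}. cmod (trig_sum (J - {i}) b' t) \<le> (c * z) * (2 * z)} \<le> ennreal H"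
          using IH[unfolded small_value_bound_def, rule_format, of "J - {i}" "c * z" "2 * z" b'] J i j c z
          by (auto simp: H_def)
        moreover have "emeasure lborel {t. t \<in> E \<and> t + s \<in> E}
          \<le> emeasure lborel {t\<in>{0..1}. cmod (trig_sum (J - {i}) b' t) \<le> (c * z) * (2 * z)}"
        proof (rule emeasure_mono)
          show "{t. t \<in> E \<and> t + s \<in> E} \<subseteq> {t\<in>{0..1}. cmod (trig_sum (J - {i}) b' t) \<le> (c * z) * (2 * z)}"
          proof safe
            fix t assume t: "t \<in> E" "t + s \<in> E"
            then show "t \<in> {0..1}" by (simp add: E_def)
            have "cmod (trig_sum (J - {i}) b' t)
              \<le> cmod (cis (- (2 * pi * (of_int i * s))) * trig_sum J b (t + s)) + cmod (trig_sum J b t)"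
              unfolding b'_def trig_sum_translate[OF J(1) i(1), symmetric] by (rule norm_triangle_ineq4)
            also have "\<dots> \<le> c * x + c * x"
              using t by (intro add_mono) (auto simp: E_def norm_mult)
            also have "\<dots> = (c * z) * (2 * z)" using z(3) by (simp add: algebra_simps)
            finally show "cmod (trig_sum (J - {i}) b' t) \<le> (c * z) * (2 * z)" .
          qed
        qed measurable
        ultimately have "emeasure lborel {t. t \<in> E \<and> t + s \<in> E} \<le> ennreal H" by simp
        then show ?thesis using False by simp
      qed
      have "emeasure lborel E * emeasure lborel E
        \<le> (\<integral>\<^sup>+s. indicator {-1..1} s * emeasure lborel {t. t \<in> E \<and> t + s \<in> E} \<partial>lborel)"
        by (rule emeasure_square_le_translates) (auto simp: E_def)
      also have "\<dots> \<le> (\<integral>\<^sup>+s. indicator B s + ennreal H * indicator {-1..1} s \<partial>lborel)"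
      proof (rule nn_integral_mono)
        fix s :: real
        show "indicator {-1..1} s * emeasure lborel {t. t \<in> E \<and> t + s \<in> E}
          \<le> indicator B s + ennreal H * indicator {-1..1} s"
          using inner[of s] by (cases "s \<in> {-1..1}") auto
      qed
      also have "\<dots> = emeasure lborel B + ennreal H * 2"
        by (subst nn_integral_add) (auto simp: nn_integral_cmult_indicator)
      also have "\<dots> \<le> ennreal (3 * z) + ennreal H * 2"
        using B by (intro add_right_mono)
      also have "\<dots> = ennreal (3 * z + H * 2)"
        using z H by (simp add: ennreal_plus ennreal_mult flip: ennreal_numeral)
      also have "\<dots> \<le> ennreal (((4 + 4 * C) * x powr (a / 4)) * ((4 + 4 * C) * x powr (a / 4)))"
      proof (rule ennreal_leI)
        \<comment> \<open>The exponent is halved once because z is the square root of x and once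
          more because the estimate bounds the square of the measure of \<open>E\<close>. The
          condition \<open>a \<le> 1\<close> lets z be absorbed into
          \<open>z powr a\<close>.\<close>
        have "z = x powr (1 / 2)" using x by (simp add: z_def powr_half_sqrt)
        then have "z powr a = x powr (a / 4 + a / 4)" by (simp add: powr_powr)
        then have xz: "x powr (a / 4) * x powr (a / 4) = z powr a" by (simp only: powr_add)
        have "z powr 1 \<le> z powr a" using z a by (intro powr_mono') auto
        then have 1: "z \<le> z powr a" using z by simp
        have "2 powr a \<le> 2 powr (1::real)" using a by (intro powr_mono) auto
        then have "(2 * z) powr a \<le> 2 * z powr a"
          unfolding powr_mult by (intro mult_right_mono) auto
        then have "H \<le> C * (2 * z powr a)" unfolding H_def using C by (intro mult_left_mono) auto
        then have "3 * z + H * 2 \<le> (4 + 4 * C) * z powr a" using 1 z(1) by (simp add: algebra_simps)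
        also have "\<dots> \<le> ((4 + 4 * C) * (4 + 4 * C)) * z powr a"
          using C mult_mono[of 1 "4 + 4 * C" "4 + 4 * C" "4 + 4 * C"] by (intro mult_right_mono) auto
        also have "\<dots> = ((4 + 4 * C) * x powr (a / 4)) * ((4 + 4 * C) * x powr (a / 4))"
          unfolding xz[symmetric] by (simp only: mult_ac)
        finally show "3 * z + H * 2 \<le> ((4 + 4 * C) * x powr (a / 4)) * ((4 + 4 * C) * x powr (a / 4))" .
      qed
      finally have le: "emeasure lborel E * emeasure lborel E \<le> \<dots>" .
      obtain m where m: "emeasure lborel E = ennreal m" "m \<ge> 0"
        using E1 by (cases "emeasure lborel E") (auto simp: top_unique)
      have nn: "0 \<le> (4 + 4 * C) * x powr (a / 4)" using C by simp
      have "m * m \<le> ((4 + 4 * C) * x powr (a / 4)) * ((4 + 4 * C) * x powr (a / 4))"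
      proof -
        have "ennreal (m * m) \<le> ennreal (((4 + 4 * C) * x powr (a / 4)) * ((4 + 4 * C) * x powr (a / 4)))"
          using le unfolding m(1) ennreal_mult[OF m(2) m(2)] .
        then show ?thesis by (rule ennreal_le_iff[THEN iffD1, rotated]) (intro mult_nonneg_nonneg nn)
      qed
      then have "m \<le> (4 + 4 * C) * x powr (a / 4)"
        by (rule power2_le_imp_le[unfolded power2_eq_square]) (rule nn)
      then show ?thesis by (simp add: m ennreal_leI)
    qed
  qed
  then show "emeasure lborel {t\<in>{0..1}. cmod (trig_sum J b t) \<le> c * x} \<le> ennreal ((4 + 4 * C) * x powr (a / 4))"
    by (simp add: E_def)
qed

lemma small_value_bound_exists: "\<exists>C a. C \<ge> 1 \<and> 0 < a \<and> a \<le> 1 \<and> small_value_bound N C a"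
proof (induction N)
  case 0
  \<comment> \<open>Vacuous: an empty \<open>J\<close> has no frequency with a large
    coefficient.\<close>
  have "small_value_bound 0 1 1" by (auto simp: small_value_bound_def)
  then show ?case by (intro exI[of _ 1]) auto
next
  case (Suc N)
  then obtain C a where "C \<ge> 1" "0 < a" "a \<le> 1" "small_value_bound N C a" by blast
  then show ?case
    using small_value_bound_step[of N C a] by (intro exI[of _ "4 + 4 * C"] exI[of _ "a / 4"]) auto
qed

section \<open>Integer relations along sequences of row vectors\<close>

text \<open>Integer vectors are embedded in this real space to make span and independence
  available.\<close>

interpretation fun_vs: vector_space "\<lambda>(c::real) (f::nat \<Rightarrow> real) j. c * f j"
  by unfold_locales (auto simp: fun_eq_iff algebra_simps)

text \<open>\<open>B\<close> is a maximal independent subset of \<open>V\<close>, finite because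
  \<open>V\<close> lies in the span of \<open>k\<close> unit vectors. Orthogonality to
  \<open>w\<close> defines a subspace, so it extends from \<open>B\<close> to its span. The lemma
  serves once for the relations and once for the row vectors.\<close>

lemma finite_subset_same_orthogonal:
  fixes V :: "(nat \<Rightarrow> real) set"
  assumes V: "\<And>v j. v \<in> V \<Longrightarrow> j \<ge> k \<Longrightarrow> v j = 0"
  obtains B where "finite B" "B \<subseteq> V"
    "\<And>w v. \<lbrakk>\<And>b. b \<in> B \<Longrightarrow> (\<Sum>j<k. w j * b j) = 0; v \<in> V\<rbrakk> \<Longrightarrow> (\<Sum>j<k. w j * v j) = 0"
proof -
  obtain B where B: "B \<subseteq> V" "fun_vs.independent B" "V \<subseteq> fun_vs.span B"
    by (rule fun_vs.maximal_independent_subset)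
  define T where "T = (\<lambda>i j. of_bool (i = j) :: real) ` {..<k}"
  have "v \<in> fun_vs.span T" if "v \<in> V" for v
  proof -
    have "v = (\<Sum>i<k. (\<lambda>j. v i * of_bool (i = j)))"
    proof
      fix j
      have "(\<Sum>i<k. (\<lambda>j. v i * of_bool (i = j))) j = (\<Sum>i<k. v i * of_bool (i = j))"
        by (induction k) (auto simp: plus_fun_def zero_fun_def)
      also have "\<dots> = v j" using V[OF that, of j] by (cases "j < k") (auto simp: of_bool_def sum.delta if_distrib cong: if_cong)
      finally show "v j = (\<Sum>i<k. (\<lambda>j. v i * of_bool (i = j))) j" by simp
    qed
    also have "\<dots> \<in> fun_vs.span T"
      by (intro fun_vs.span_sum fun_vs.span_scale fun_vs.span_base) (auto simp: T_def)
    finally show ?thesis .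
  qed
  then have "finite B"
    using fun_vs.independent_span_bound[of T B] B by (auto simp: T_def)
  moreover have "(\<Sum>j<k. w j * v j) = 0" if w: "\<And>b. b \<in> B \<Longrightarrow> (\<Sum>j<k. w j * b j) = 0" and v: "v \<in> V" for w v
  proof -
    have "fun_vs.subspace {v. (\<Sum>j<k. w j * v j) = 0}"
      by (rule fun_vs.subspaceI)
         (auto simp: plus_fun_def zero_fun_def algebra_simps sum.distrib simp flip: sum_distrib_left)
    then have "fun_vs.span B \<subseteq> {v. (\<Sum>j<k. w j * v j) = 0}"
      by (intro fun_vs.span_minimal) (use w in auto)
    then show ?thesis using B v by auto
  qed
  ultimately show ?thesis using that B(1) by blast
qed

section \<open>Relations of integer matrices and convergence of matrices\<close>

definition exponents :: "nat \<Rightarrow> (nat \<Rightarrow>\<^sub>0 int) set" where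
  "exponents k = {m. Poly_Mapping.keys m \<subseteq> {..<k}}"

lemma lookup_exponents: "m \<in> exponents k \<Longrightarrow> j \<ge> k \<Longrightarrow> Poly_Mapping.lookup m j = 0"
  by (auto simp: exponents_def in_keys_iff)

lemma countable_exponents: "countable (exponents k)"
proof (rule countable_image_inj_on)
  let ?f = "\<lambda>m. restrict (Poly_Mapping.lookup m) {..<k}"
  have "?f ` exponents k \<subseteq> Pi\<^sub>E {..<k} (\<lambda>_. UNIV)" by (auto simp: PiE_def extensional_def)
  moreover have "countable (Pi\<^sub>E {..<k} (\<lambda>_. UNIV :: int set))" by (intro countable_PiE) auto
  ultimately show "countable (?f ` exponents k)" by (rule countable_subset)
  show "inj_on ?f (exponents k)"
  proof (rule inj_onI, rule poly_mapping_eqI)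
    fix m m' j assume m: "m \<in> exponents k" "m' \<in> exponents k" "?f m = ?f m'"
    show "Poly_Mapping.lookup m j = Poly_Mapping.lookup m' j"
    proof (cases "j < k")
      case True
      then show ?thesis using fun_cong[OF m(3), of j] by simp
    qed (use m(1,2) in \<open>simp add: lookup_exponents\<close>)
  qed
qed

lemma mat_exponent_eq_0_iff:
  assumes "A \<in> carrier_mat l k"
  shows "mat_exponent A m = 0 \<longleftrightarrow> (\<forall>i<l. (\<Sum>j<k. A $$ (i, j) * Poly_Mapping.lookup m j) = 0)"
  using assms by (auto simp: poly_mapping_eq_iff fun_eq_iff lookup_mat_exponent)

lemma mat_exponent_row_eq_0_iff:
  assumes "r \<in> carrier_vec k"
  shows "mat_exponent (mat_of_row r) m = 0 \<longleftrightarrow> (\<Sum>j<k. r $ j * Poly_Mapping.lookup m j) = 0"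
  using assms by (subst mat_exponent_eq_0_iff[of _ 1 k]) (auto simp: mat_of_row_def)

text \<open>This is convergence of \<open>R\<close> to \<open>A\<close>. The threshold for
  \<open>n\<close> may depend on \<open>m\<close>, which suffices because each trigonometric
  polynomial involves finitely many exponents; the numbers of rows may differ.\<close>

definition same_relations :: "nat \<Rightarrow> (nat \<Rightarrow> int mat) \<Rightarrow> int mat \<Rightarrow> bool" where
  "same_relations k R A \<longleftrightarrow>
     (\<forall>m\<in>exponents k. \<forall>\<^sub>F n in sequentially. mat_exponent (R n) m = 0 \<longleftrightarrow> mat_exponent A m = 0)"

lemma same_relations_subsequence:
  fixes r :: "nat \<Rightarrow> int Matrix.vec"
  assumes r: "\<And>n. r n \<in> carrier_vec k"
  obtains \<sigma> l A where "strict_mono \<sigma>" "A \<in> carrier_mat l k"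
    "same_relations k (\<lambda>n. mat_of_row (r (\<sigma> n))) A"
proof -
  define ip where "ip = (\<lambda>n m. \<Sum>j<k. r n $ j * Poly_Mapping.lookup m j)"
  \<comment> \<open>Truth values are coded as the reals 0 and 1, so that the diagonal argument for
    bounded functions on a countable set applies.\<close>
  define f where "f = (\<lambda>n m. of_bool (ip n m = 0) :: real)"
  have "\<exists>\<sigma>. strict_mono \<sigma> \<and> (\<forall>m\<in>exponents k. \<exists>c. (\<lambda>n. f (\<sigma> n) m) \<longlonglongrightarrow> c)"
    by (rule function_convergent_subsequence[OF countable_exponents[of k], of f 1]) (auto simp: f_def)
  then obtain \<sigma> where \<sigma>: "strict_mono \<sigma>" "\<And>m. m \<in> exponents k \<Longrightarrow> \<exists>c. (\<lambda>n. f (\<sigma> n) m) \<longlonglongrightarrow> c"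
    by blast
  define L where "L = {m\<in>exponents k. \<forall>\<^sub>F n in sequentially. ip (\<sigma> n) m = 0}"
  have dich: "\<forall>\<^sub>F n in sequentially. ip (\<sigma> n) m = 0 \<longleftrightarrow> m \<in> L" if m: "m \<in> exponents k" for m
  proof -
    obtain c where c: "(\<lambda>n. f (\<sigma> n) m) \<longlonglongrightarrow> c" using \<sigma>(2)[OF m] by blast
    show ?thesis
    \<comment> \<open>A convergent sequence of zeros and ones is eventually constant; comparing the
      limit with 1 / 2 tells which value it takes.\<close>
    proof (cases "c > 1 / 2")
      case True
      have "\<forall>\<^sub>F n in sequentially. f (\<sigma> n) m > 1 / 2" using order_tendstoD(1)[OF c True] .
      then have *: "\<forall>\<^sub>F n in sequentially. ip (\<sigma> n) m = 0"
        by eventually_elim (auto simp: f_def of_bool_def split: if_splits)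
      then have "m \<in> L" using m by (simp add: L_def)
      then show ?thesis using * by (auto elim: eventually_mono)
    next
      case False
      then have "\<forall>\<^sub>F n in sequentially. f (\<sigma> n) m < 1" by (intro order_tendstoD(2)[OF c]) auto
      then have *: "\<forall>\<^sub>F n in sequentially. ip (\<sigma> n) m \<noteq> 0"
        by eventually_elim (auto simp: f_def of_bool_def split: if_splits)
      have "m \<notin> L"
      proof
        assume "m \<in> L"
        then have "\<forall>\<^sub>F n in sequentially. ip (\<sigma> n) m = 0" by (simp add: L_def)
        with * have "\<forall>\<^sub>F n in sequentially. False" by eventually_elim auto
        then show False by simp
      qed
      then show ?thesis using * by (auto elim: eventually_mono)
    qed
  qed
  have ip_real: "of_int (ip n m) = (\<Sum>j<k. real_of_int (r n $ j) * real_of_int (Poly_Mapping.lookup m j))" for n m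
    by (simp add: ip_def)
  define g where "g = (\<lambda>(m :: nat \<Rightarrow>\<^sub>0 int) j. real_of_int (Poly_Mapping.lookup m j))"
  obtain B where B: "finite B" "B \<subseteq> g ` L"
    "\<And>w v. \<lbrakk>\<And>b. b \<in> B \<Longrightarrow> (\<Sum>j<k. w j * b j) = 0; v \<in> g ` L\<rbrakk> \<Longrightarrow> (\<Sum>j<k. w j * v j) = 0"
    by (rule finite_subset_same_orthogonal[of "g ` L" k])
       (auto simp: g_def L_def lookup_exponents)
  obtain M where M: "finite M" "M \<subseteq> L" "B = g ` M"
    using finite_subset_image[OF B(1,2)] by blast
  have "\<forall>\<^sub>F n in sequentially. \<forall>m\<in>M. ip (\<sigma> n) m = 0"
    by (rule eventually_ball_finite) (use M in \<open>auto simp: L_def\<close>)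
  then obtain N where N: "\<And>n m. n \<ge> N \<Longrightarrow> m \<in> M \<Longrightarrow> ip (\<sigma> n) m = 0"
    by (auto simp: eventually_sequentially)
  \<comment> \<open>The index \<open>N\<close> was chosen for the finite set \<open>M\<close>, but
    the relations in \<open>M\<close> imply all those in \<open>L\<close>.\<close>
  have NL: "ip (\<sigma> n) m = 0" if "n \<ge> N" "m \<in> L" for n m
  proof -
    have "(\<Sum>j<k. real_of_int (r (\<sigma> n) $ j) * g m j) = 0"
    proof (rule B(3))
      fix b assume "b \<in> B"
      then obtain m' where m': "m' \<in> M" "b = g m'" using M by blast
      have "real_of_int (ip (\<sigma> n) m') = 0" using N that m' by simp
      then show "(\<Sum>j<k. real_of_int (r (\<sigma> n) $ j) * b j) = 0" by (simp only: ip_real m' g_def)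
    qed (use that in auto)
    then have "real_of_int (ip (\<sigma> n) m) = 0" by (simp only: ip_real g_def)
    then show ?thesis by simp
  qed
  define h where "h = (\<lambda>n j. if j < k then real_of_int (r (\<sigma> n) $ j) else 0)"
  obtain B' where B': "finite B'" "B' \<subseteq> h ` {N..}"
    "\<And>w v. \<lbrakk>\<And>b. b \<in> B' \<Longrightarrow> (\<Sum>j<k. w j * b j) = 0; v \<in> h ` {N..}\<rbrakk> \<Longrightarrow> (\<Sum>j<k. w j * v j) = 0"
    by (rule finite_subset_same_orthogonal[of "h ` {N..}" k]) (auto simp: h_def)
  obtain I where I: "finite I" "I \<subseteq> {N..}" "B' = h ` I"
    using finite_subset_image[OF B'(1,2)] by blast
  obtain ns where ns: "set ns = I" using finite_list[OF I(1)] by blast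
  \<comment> \<open>If all \<open>r (\<sigma> n)\<close> with \<open>n \<ge> N\<close> vanish, then
    \<open>I\<close> may be empty and \<open>A\<close> has no rows, so every relation holds for
    it.\<close>
  define A where "A = Matrix.mat (length ns) k (\<lambda>(i, j). r (\<sigma> (ns ! i)) $ j)"
  have A: "A \<in> carrier_mat (length ns) k" by (simp add: A_def)
  have A0: "mat_exponent A m = 0 \<longleftrightarrow> (\<forall>n\<in>I. ip (\<sigma> n) m = 0)" for m
  proof -
    have "mat_exponent A m = 0 \<longleftrightarrow> (\<forall>i<length ns. ip (\<sigma> (ns ! i)) m = 0)"
      unfolding mat_exponent_eq_0_iff[OF A] ip_def by (simp add: A_def)
    then show ?thesis by (auto simp: all_set_conv_all_nth simp flip: ns)
  qed
  have AL: "mat_exponent A m = 0 \<longleftrightarrow> m \<in> L" if m: "m \<in> exponents k" for m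
  proof
    assume "m \<in> L"
    then show "mat_exponent A m = 0" using NL I(2) by (auto simp: A0)
  next
    assume Am: "mat_exponent A m = 0"
    have "ip (\<sigma> n) m = 0" if n: "n \<ge> N" for n
    proof -
      have "(\<Sum>j<k. g m j * h n j) = 0"
      proof (rule B'(3))
        fix b assume "b \<in> B'"
        then obtain n' where n': "n' \<in> I" "b = h n'" using I by blast
        have "real_of_int (ip (\<sigma> n') m) = 0" using Am n' by (simp add: A0)
        then show "(\<Sum>j<k. g m j * b j) = 0" by (simp add: ip_real n' g_def h_def mult.commute)
      qed (use n in auto)
      then have "real_of_int (ip (\<sigma> n) m) = 0" by (simp add: ip_real g_def h_def mult.commute)
      then show ?thesis by simp
    qed
    then show "m \<in> L" using m by (auto simp: L_def eventually_sequentially)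
  qed
  have "same_relations k (\<lambda>n. mat_of_row (r (\<sigma> n))) A"
    unfolding same_relations_def mat_exponent_row_eq_0_iff[OF r]
    using dich AL by (simp add: ip_def)
  then show ?thesis using that \<sigma>(1) A by blast
qed

text \<open>The product of \<open>r n\<close> with \<open>m\<close> is a polynomial in
  \<open>n\<close> whose coefficients are the entries of \<open>A m\<close>. It vanishes identically
  if \<open>A m = 0\<close> and for only finitely many \<open>n\<close> otherwise.\<close>

lemma same_relations_row_sequence:
  assumes A: "A \<in> carrier_mat l k"
  obtains r where "\<And>n. r n \<in> carrier_vec k" "same_relations k (\<lambda>n. mat_of_row (r n)) A"
proof
  define r where "r = (\<lambda>n. Matrix.vec k (\<lambda>j. \<Sum>i<l. int n ^ i * A $$ (i, j)))"
  show r: "r n \<in> carrier_vec k" for n by (simp add: r_def)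
  show "same_relations k (\<lambda>n. mat_of_row (r n)) A"
    unfolding same_relations_def mat_exponent_row_eq_0_iff[OF r]
  proof
    fix m
    \<comment> \<open>The extra zero coefficient at index \<open>l\<close> adapts the sum over i < l
      to the form with i \<le> l in the theorem on roots of polynomials.\<close>
    define c where "c = (\<lambda>i. if i < l then \<Sum>j<k. A $$ (i, j) * Poly_Mapping.lookup m j else 0)"
    have "(\<Sum>j<k. r n $ j * Poly_Mapping.lookup m j) = (\<Sum>i<l. c i * int n ^ i)" for n
    proof -
      have "(\<Sum>j<k. r n $ j * Poly_Mapping.lookup m j)
        = (\<Sum>j<k. \<Sum>i<l. int n ^ i * (A $$ (i, j) * Poly_Mapping.lookup m j))"
        by (simp add: r_def sum_distrib_right mult.assoc)
      also have "\<dots> = (\<Sum>i<l. \<Sum>j<k. int n ^ i * (A $$ (i, j) * Poly_Mapping.lookup m j))"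
        by (rule sum.swap)
      finally show ?thesis by (simp add: c_def sum_distrib_left mult.commute)
    qed
    also have "\<And>n. (\<Sum>i<l. c i * int n ^ i) = (\<Sum>i\<le>l. c i * int n ^ i)"
      by (simp add: c_def flip: lessThan_Suc_atMost)
    finally have ip: "(\<Sum>j<k. r n $ j * Poly_Mapping.lookup m j) = (\<Sum>i\<le>l. c i * int n ^ i)" for n .
    have A0: "mat_exponent A m = 0 \<longleftrightarrow> (\<forall>i<l. c i = 0)"
      by (simp add: mat_exponent_eq_0_iff[OF A] c_def)
    show "\<forall>\<^sub>F n in sequentially. ((\<Sum>j<k. r n $ j * Poly_Mapping.lookup m j) = 0) = (mat_exponent A m = 0)"
    proof (cases "mat_exponent A m = 0")
      case True
      then have "c i = 0" for i using A0 by (cases "i < l") (auto simp: c_def)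
      then show ?thesis using True by (simp add: ip)
    next
      case False
      then obtain i where "i \<le> l" "c i \<noteq> 0" using A0 by (auto intro: less_imp_le)
      then have "\<exists>i\<le>l. real_of_int (c i) \<noteq> 0" by auto
      then have "finite {x. (\<Sum>i\<le>l. real_of_int (c i) * x ^ i) = 0}"
        by (subst polyfun_finite_roots)
      then have "finite (real -` {x. (\<Sum>i\<le>l. real_of_int (c i) * x ^ i) = 0})"
        by (rule finite_vimageI) simp
      moreover have "(\<Sum>i\<le>l. c i * int n ^ i) = 0 \<longleftrightarrow> (\<Sum>i\<le>l. real_of_int (c i) * real n ^ i) = 0" for n
        by (subst of_int_eq_0_iff[where ?'a = real, symmetric]) simp
      ultimately have "finite {n. (\<Sum>i\<le>l. c i * int n ^ i) = 0}"
        by (simp add: vimage_def)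
      then have "\<forall>\<^sub>F n in cofinite. (\<Sum>i\<le>l. c i * int n ^ i) \<noteq> 0"
        by (simp add: eventually_cofinite)
      then show ?thesis using False by (simp add: ip cofinite_eq_sequentially)
    qed
  qed
qed

section \<open>Characters of the torus\<close>

definition unit_interval :: "real measure" where
  "unit_interval = restrict_space lborel {0..1}"

definition unit_cube :: "nat \<Rightarrow> (nat \<Rightarrow> real) measure" where
  "unit_cube l = (\<Pi>\<^sub>M i\<in>{..<l}. unit_interval)"

text \<open>The monomial with exponent vector \<open>v\<close> on the torus, in angular
  coordinates.\<close>

definition character :: "nat \<Rightarrow> (nat \<Rightarrow>\<^sub>0 int) \<Rightarrow> (nat \<Rightarrow> real) \<Rightarrow> complex" where
  "character l v t = cis (2 * pi * (\<Sum>i<l. of_int (Poly_Mapping.lookup v i) * t i))"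

lemma character_0 [simp]: "character l 0 t = 1"
  by (simp add: character_def)

lemma character_add: "character l (v + w) t = character l v t * character l w t"
  by (simp add: character_def cis_mult lookup_add algebra_simps sum.distrib)

lemma character_uminus: "character l (- v) t = cnj (character l v t)"
  by (simp add: character_def cis_cnj sum_negf)

lemma norm_character [simp]: "norm (character l v t) = 1"
  by (simp add: character_def)

lemma character_prod:
  "character l v t = (\<Prod>i<l. cis (2 * pi * (of_int (Poly_Mapping.lookup v i) * t i)))"
  by (induction l) (simp_all add: character_def distrib_left flip: cis_mult)

lemma prob_space_unit_interval: "prob_space unit_interval"
  by (rule prob_spaceI) (simp add: unit_interval_def emeasure_restrict_space)

lemma space_unit_interval: "space unit_interval = {0..1}"
  by (simp add: unit_interval_def)

lemma prob_space_unit_cube: "prob_space (unit_cube l)"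
  unfolding unit_cube_def by (intro prob_space_PiM prob_space_unit_interval)

lemma measurable_unit_interval_ident [measurable]: "(\<lambda>s. s) \<in> borel_measurable unit_interval"
  unfolding unit_interval_def by (rule measurable_restrict_space1) simp

lemma measurable_coordinate [measurable]:
  assumes "i < l"
  shows "(\<lambda>t. t i) \<in> borel_measurable (unit_cube l)"
proof -
  have "(\<lambda>t. t i) \<in> measurable (unit_cube l) unit_interval"
    unfolding unit_cube_def by (rule measurable_component_singleton) (use assms in simp)
  then show ?thesis
    by (rule measurable_compose[OF _ measurable_unit_interval_ident])
qed

lemma measurable_cis [measurable]: "cis \<in> borel_measurable borel"
  by (intro borel_measurable_continuous_onI continuous_intros)

lemma measurable_character [measurable]: "character l v \<in> borel_measurable (unit_cube l)"
proof -
  have "(\<lambda>t. 2 * pi * (\<Sum>i<l. real_of_int (Poly_Mapping.lookup v i) * t i)) \<in> borel_measurable (unit_cube l)"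
    by (intro borel_measurable_times borel_measurable_const borel_measurable_sum) auto
  then have "(\<lambda>t. cis (2 * pi * (\<Sum>i<l. real_of_int (Poly_Mapping.lookup v i) * t i))) \<in> borel_measurable (unit_cube l)"
    by (rule measurable_compose[OF _ measurable_cis])
  then show ?thesis unfolding character_def .
qed

lemma integrable_character [simp]: "integrable (unit_cube l) (character l v)"
proof -
  interpret prob_space "unit_cube l" by (rule prob_space_unit_cube)
  show ?thesis by (rule integrable_const_bound[of _ 1]) auto
qed

lemma integral_cis_unit_interval:
  fixes n :: int
  shows "(\<integral>s. cis (2 * pi * (of_int n * s)) \<partial>unit_interval) = of_bool (n = 0)"
proof (cases "n = 0")
  case True
  interpret prob_space unit_interval by (rule prob_space_unit_interval)
  show ?thesis using True by (simp add: prob_space)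
next
  case False
  define F where "F = (\<lambda>s. cis (2 * pi * (of_int n * s)) / (2 * pi * \<i> * of_int n))"
  have "(\<integral>s. cis (2 * pi * (of_int n * s)) \<partial>unit_interval)
     = (\<integral>s. indicator {0..1} s *\<^sub>R cis (2 * pi * (of_int n * s)) \<partial>lborel)"
    unfolding unit_interval_def by (subst integral_restrict_space) auto
  also have "\<dots> = F 1 - F 0"
  proof (rule integral_FTC_Icc)
    show "(F has_vector_derivative cis (2 * pi * (of_int n * s))) (at s within {0..1})" for s
      unfolding F_def cis_conv_exp using False
      by (auto intro!: derivative_eq_intros has_vector_derivative_real_field simp: field_simps)
    show "continuous_on {0..1} (\<lambda>s. cis (2 * pi * (real_of_int n * s)))"
      by (intro continuous_intros)
  qed simp
  also have "F 1 = F 0" by (simp add: F_def cis_multiple_2pi)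
  finally show ?thesis using False by simp
qed

text \<open>The character is a product of functions of one coordinate each, so Fubini reduces the
  claim to orthogonality on the circle.\<close>

lemma integral_character:
  "(\<integral>t. character l v t \<partial>unit_cube l) = of_bool (\<forall>i<l. Poly_Mapping.lookup v i = 0)"
proof -
  interpret product_sigma_finite "\<lambda>_::nat. unit_interval"
    by (simp add: product_sigma_finite_def prob_space_unit_interval prob_space_imp_sigma_finite)
  interpret I: prob_space unit_interval by (rule prob_space_unit_interval)
  have "integrable unit_interval (\<lambda>s. cis (2 * pi * (of_int n * s)))" for n :: int
    by (rule I.integrable_const_bound[of _ 1]) (auto intro!: measurable_compose[OF _ measurable_cis])
  then have "(\<integral>t. character l v t \<partial>unit_cube l)
     = (\<Prod>i<l. \<integral>s. cis (2 * pi * (of_int (Poly_Mapping.lookup v i) * s)) \<partial>unit_interval)"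
    unfolding character_prod unit_cube_def
    by (intro product_integral_prod) auto
  also have "\<dots> = of_bool (\<forall>i<l. Poly_Mapping.lookup v i = 0)"
    unfolding integral_cis_unit_interval by (induction l) (auto simp: less_Suc_eq)
  finally show ?thesis .
qed

lemma integral_character_mat_exponent:
  assumes "A \<in> carrier_mat l k"
  shows "(\<integral>t. character l (mat_exponent A m) t \<partial>unit_cube l) = of_bool (mat_exponent A m = 0)"
proof -
  have "(\<forall>i<l. Poly_Mapping.lookup (mat_exponent A m) i = 0) \<longleftrightarrow> mat_exponent A m = 0"
    using assms by (auto simp: poly_mapping_eq_iff fun_eq_iff lookup_mat_exponent)
  then show ?thesis by (simp only: integral_character)
qed

section \<open>Trigonometric polynomials parametrised by a matrix\<close>

lemma mat_exponent_add: "mat_exponent A (m + m') = mat_exponent A m + mat_exponent A m'"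
  by (rule poly_mapping_eqI) (simp add: lookup_mat_exponent lookup_add algebra_simps sum.distrib)

lemma mat_exponent_uminus: "mat_exponent A (- m) = - mat_exponent A m"
  by (rule poly_mapping_eqI) (simp add: lookup_mat_exponent sum_negf)

lemma mat_exponent_0 [simp]: "mat_exponent A 0 = 0"
  by (rule poly_mapping_eqI) (simp add: lookup_mat_exponent)

lemma mat_exponent_diff: "mat_exponent A (m - m') = mat_exponent A m - mat_exponent A m'"
  using mat_exponent_add[of A m "- m'"] by (simp add: mat_exponent_uminus)

lemma exponents_add: "m \<in> exponents k \<Longrightarrow> m' \<in> exponents k \<Longrightarrow> m + m' \<in> exponents k"
  using keys_add[of m m'] by (auto simp: exponents_def)

lemma exponents_uminus: "m \<in> exponents k \<Longrightarrow> - m \<in> exponents k"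
  by (simp add: exponents_def)

lemma exponents_0: "0 \<in> exponents k"
  by (simp add: exponents_def)

text \<open>
  Trigonometric polynomials depending on a matrix through the substitution of exponents only.
  They are closed under products, and their integral depends on the matrix only through the
  relations \<open>A m = 0\<close> among the finitely many exponents that occur.
\<close>

inductive trig_family :: "nat \<Rightarrow> (int mat \<Rightarrow> (nat \<Rightarrow> real) \<Rightarrow> complex) \<Rightarrow> bool" for k where
  trig_family_0: "trig_family k (\<lambda>A t. 0)"
| trig_family_step: "m \<in> exponents k \<Longrightarrow> trig_family k G \<Longrightarrow>
    trig_family k (\<lambda>A t. d * character (dim_row A) (mat_exponent A m) t + G A t)"

lemma trig_family_character:
  "m \<in> exponents k \<Longrightarrow> trig_family k (\<lambda>A t. d * character (dim_row A) (mat_exponent A m) t)"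
  using trig_family_step[OF _ trig_family_0, where d = d] by fastforce

lemma trig_family_const: "trig_family k (\<lambda>A t. d)"
  using trig_family_character[OF exponents_0, where d = d] by simp

lemma trig_family_add:
  assumes "trig_family k G" "trig_family k H"
  shows "trig_family k (\<lambda>A t. G A t + H A t)"
  using assms by (induction) (simp_all add: add.assoc trig_family_step)

lemma trig_family_sum:
  assumes "\<And>x. x \<in> S \<Longrightarrow> trig_family k (G x)"
  shows "trig_family k (\<lambda>A t. \<Sum>x\<in>S. G x A t)"
  using assms by (induction S rule: infinite_finite_induct) (simp_all add: trig_family_0 trig_family_add)

lemma trig_family_character_mult:
  assumes "trig_family k G" "m \<in> exponents k"
  shows "trig_family k (\<lambda>A t. d * character (dim_row A) (mat_exponent A m) t * G A t)"
  using assms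
proof induction
  case (trig_family_step m' G d')
  have "trig_family k (\<lambda>A t. (d * d') * character (dim_row A) (mat_exponent A (m + m')) t
      + d * character (dim_row A) (mat_exponent A m) t * G A t)"
    using trig_family_step by (intro trig_family.trig_family_step exponents_add) auto
  then show ?case by (simp add: mat_exponent_add character_add algebra_simps)
qed (simp add: trig_family_0)

lemma trig_family_mult:
  assumes "trig_family k G" "trig_family k H"
  shows "trig_family k (\<lambda>A t. G A t * H A t)"
  using assms
  by induction
    (simp_all add: trig_family_0 distrib_right trig_family_add trig_family_character_mult)

lemma trig_family_cnj:
  assumes "trig_family k G"
  shows "trig_family k (\<lambda>A t. cnj (G A t))"
  using assms
proof induction
  case (trig_family_step m G d)
  have "trig_family k (\<lambda>A t. cnj d * character (dim_row A) (mat_exponent A (- m)) t + cnj (G A t))"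
    using trig_family_step by (intro trig_family.trig_family_step exponents_uminus) auto
  then show ?case by (simp add: mat_exponent_uminus character_uminus)
qed (simp add: trig_family_0)

lemma trig_family_power:
  assumes "trig_family k G"
  shows "trig_family k (\<lambda>A t. G A t ^ n)"
  by (induction n) (simp_all add: trig_family_const trig_family_mult assms)

lemma trig_family_integrable:
  assumes "trig_family k G"
  shows "integrable (unit_cube (dim_row A)) (G A)"
  using assms by induction auto

text \<open>By orthogonality a term contributes \<open>d\<close> or 0 according to whether the
  relation of its exponent \<open>m\<close> holds, and the induction intersects finitely many
  eventual conditions.\<close>

lemma trig_family_integral_eq:
  assumes G: "trig_family k G" and A: "A \<in> carrier_mat l k"
    and R: "\<And>n. R n \<in> carrier_mat l' k" and same: "same_relations k R A"
  shows "\<forall>\<^sub>F n in sequentially. (\<integral>t. G (R n) t \<partial>unit_cube l') = (\<integral>t. G A t \<partial>unit_cube l)"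
  using G
proof induction
  case (trig_family_step m G d)
  have dims: "dim_row A = l" "dim_row (R n) = l'" for n using A R[of n] by auto
  have int: "integrable (unit_cube l) (G A)" "integrable (unit_cube l') (G (R n))" for n
    using trig_family_integrable[OF trig_family_step(2)] by (metis dims)+
  have "\<forall>\<^sub>F n in sequentially. mat_exponent (R n) m = 0 \<longleftrightarrow> mat_exponent A m = 0"
    using same trig_family_step(1) by (simp add: same_relations_def)
  then show ?case using trig_family_step(3)
  proof eventually_elim
    case (elim n)
    then show ?case
      using int(1) int(2)[of n]
      by (simp add: dims integral_character_mat_exponent[OF A] integral_character_mat_exponent[OF R])
  qed
qed simp

section \<open>Mahler measures\<close>

definition torus_value :: "laurent \<Rightarrow> int mat \<Rightarrow> (nat \<Rightarrow> real) \<Rightarrow> complex" where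
  "torus_value F A t = (\<Sum>m\<in>Poly_Mapping.keys F.
     Poly_Mapping.lookup F m * character (dim_row A) (mat_exponent A m) t)"

lemma laurent_eval_subst_torus:
  "laurent_eval (laurent_subst F A) (\<lambda>i. exp (2 * of_real pi * \<i> * of_real (t i))) = torus_value F A t"
proof -
  have powi: "exp (2 * of_real pi * \<i> * of_real s) powi n = cis (2 * pi * (of_int n * s))" for s n
  proof -
    have "exp (2 * of_real pi * \<i> * of_real s) = cis (2 * pi * s)"
      by (simp add: cis_conv_exp mult_ac)
    then show ?thesis by (simp add: cis_power_int mult_ac)
  qed
  have "(\<Prod>i\<in>Poly_Mapping.keys (mat_exponent A m).
      exp (2 * of_real pi * \<i> * of_real (t i)) powi Poly_Mapping.lookup (mat_exponent A m) i)
    = character (dim_row A) (mat_exponent A m) t" for m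
    unfolding character_prod powi
    by (rule prod.mono_neutral_left) (use keys_mat_exponent[of A m] in \<open>auto simp: in_keys_iff\<close>)
  then show ?thesis
    by (simp add: laurent_subst_def laurent_eval_sum laurent_eval_single torus_value_def)
qed

lemma torus_value_measurable:
  "torus_value F A \<in> borel_measurable (unit_cube (dim_row A))"
  unfolding torus_value_def by measurable

lemma norm_torus_value_le:
  "cmod (torus_value F A t) \<le> (\<Sum>m\<in>Poly_Mapping.keys F. cmod (Poly_Mapping.lookup F m))"
  unfolding torus_value_def by (rule sum_norm_le) (simp add: norm_mult)

text \<open>The square is introduced because the squared modulus is itself a trigonometric
  polynomial.\<close>

lemma mahler_measure_subst:
  assumes "A \<in> carrier_mat l k"
  shows "mahler_measure l (laurent_subst F A)
    = (\<integral>t. ln ((cmod (torus_value F A t))\<^sup>2) \<partial>unit_cube l) / 2"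
proof -
  \<comment> \<open>This includes \<open>w = 0\<close>, where both sides are 0 by
    convention.\<close>
  have "ln ((cmod w)\<^sup>2) = 2 * ln (cmod w)" for w
    by (simp add: ln_realpow)
  then show ?thesis
    by (simp add: mahler_measure_def laurent_eval_subst_torus unit_cube_def unit_interval_def)
qed

lemma trig_family_torus_value:
  assumes "F \<in> laurent_polys k"
  shows "trig_family k (torus_value F)"
proof -
  have "trig_family k (\<lambda>A t. torus_value F A t)"
    unfolding torus_value_def
    by (intro trig_family_sum trig_family_character)
       (use assms in \<open>auto simp: laurent_polys_def exponents_def\<close>)
  then show ?thesis .
qed

text \<open>The squared modulus is the product of \<open>torus_value\<close> with its conjugate, so
  its powers form a \<open>trig_family\<close>.\<close>

lemma torus_value_moments_eq:
  assumes F: "F \<in> laurent_polys k" and A: "A \<in> carrier_mat l k"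
    and R: "\<And>n. R n \<in> carrier_mat l' k" and same: "same_relations k R A"
  shows "\<forall>\<^sub>F n in sequentially. (\<integral>t. ((cmod (torus_value F (R n) t))\<^sup>2) ^ j \<partial>unit_cube l')
    = (\<integral>t. ((cmod (torus_value F A t))\<^sup>2) ^ j \<partial>unit_cube l)"
proof -
  have "trig_family k (\<lambda>A t. (torus_value F A t * cnj (torus_value F A t)) ^ j)"
    by (intro trig_family_power trig_family_mult trig_family_cnj trig_family_torus_value F)
  from trig_family_integral_eq[OF this A R same] show ?thesis
  proof eventually_elim
    case (elim n)
    have "complex_of_real (\<integral>t. ((cmod (torus_value F (R n) t))\<^sup>2) ^ j \<partial>unit_cube l')
      = complex_of_real (\<integral>t. ((cmod (torus_value F A t))\<^sup>2) ^ j \<partial>unit_cube l)"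
      unfolding integral_complex_of_real[symmetric] using elim
      by (simp only: of_real_power complex_norm_square[unfolded of_real_power])
    then show ?case by (simp only: of_real_eq_iff)
  qed
qed

section \<open>Vanishing of the substituted polynomial\<close>

lemma lookup_laurent_subst:
  "Poly_Mapping.lookup (laurent_subst F A) v
    = (\<Sum>m\<in>{m\<in>Poly_Mapping.keys F. mat_exponent A m = v}. Poly_Mapping.lookup F m)"
proof -
  have "Poly_Mapping.lookup (laurent_subst F A) v
    = (\<Sum>m\<in>Poly_Mapping.keys F. if mat_exponent A m = v then Poly_Mapping.lookup F m else 0)"
    by (simp add: laurent_subst_def lookup_sum lookup_single when_def)
  then show ?thesis by (simp add: sum.If_cases Int_def)
qed

text \<open>Two monomials collect exactly when the difference of their exponents is a relation of
  \<open>A\<close>. In this form vanishing depends on \<open>A\<close> only through its relations,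
  so it transfers along \<open>same_relations\<close>.\<close>

lemma laurent_subst_eq_0_iff:
  "laurent_subst F A = 0 \<longleftrightarrow> (\<forall>m\<in>Poly_Mapping.keys F.
     (\<Sum>m'\<in>{m'\<in>Poly_Mapping.keys F. mat_exponent A (m' - m) = 0}. Poly_Mapping.lookup F m') = 0)"
proof -
  have "laurent_subst F A = 0 \<longleftrightarrow> (\<forall>v. Poly_Mapping.lookup (laurent_subst F A) v = 0)"
    by (auto simp: poly_mapping_eq_iff fun_eq_iff)
  also have "\<dots> \<longleftrightarrow> (\<forall>m\<in>Poly_Mapping.keys F. Poly_Mapping.lookup (laurent_subst F A) (mat_exponent A m) = 0)"
  proof safe
    fix v assume *: "\<forall>m\<in>Poly_Mapping.keys F. Poly_Mapping.lookup (laurent_subst F A) (mat_exponent A m) = 0"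
    show "Poly_Mapping.lookup (laurent_subst F A) v = 0"
    proof (cases "v \<in> mat_exponent A ` Poly_Mapping.keys F")
      case False
      then have "{m\<in>Poly_Mapping.keys F. mat_exponent A m = v} = {}" by auto
      then show ?thesis by (simp only: lookup_laurent_subst sum.empty)
    qed (use * in auto)
  qed auto
  finally show ?thesis by (simp add: lookup_laurent_subst mat_exponent_diff)
qed

lemma same_relations_laurent_subst_eq_0:
  assumes F: "F \<in> laurent_polys k" and same: "same_relations k R A"
  shows "\<forall>\<^sub>F n in sequentially. laurent_subst F (R n) = 0 \<longleftrightarrow> laurent_subst F A = 0"
proof -
  have "\<forall>\<^sub>F n in sequentially. \<forall>m\<in>Poly_Mapping.keys F. \<forall>m'\<in>Poly_Mapping.keys F.
      mat_exponent (R n) (m' - m) = 0 \<longleftrightarrow> mat_exponent A (m' - m) = 0"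
  proof (intro eventually_ball_finite ballI finite_keys)
    fix m m' assume "m \<in> Poly_Mapping.keys F" "m' \<in> Poly_Mapping.keys F"
    then have "m' - m \<in> exponents k"
      using F exponents_add[of m' k "- m"] exponents_uminus[of m k]
      by (auto simp: laurent_polys_def exponents_def)
    then show "\<forall>\<^sub>F n in sequentially. mat_exponent (R n) (m' - m) = 0 \<longleftrightarrow> mat_exponent A (m' - m) = 0"
      using same by (simp add: same_relations_def)
  qed
  then show ?thesis
  proof eventually_elim
    case (elim n)
    have "{m'\<in>Poly_Mapping.keys F. mat_exponent (R n) (m' - m) = 0}
       = {m'\<in>Poly_Mapping.keys F. mat_exponent A (m' - m) = 0}" if "m \<in> Poly_Mapping.keys F" for m
      using elim that by auto
    then show ?case by (simp add: laurent_subst_eq_0_iff)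
  qed
qed

section \<open>Small values for matrices with a single row\<close>

lemma measure_unit_cube_1:
  assumes [measurable]: "Measurable.pred borel P"
  shows "measure (unit_cube 1) {t\<in>space (unit_cube 1). P (t 0)} = measure lborel {s\<in>{0..1}. P s}"
proof -
  interpret product_sigma_finite "\<lambda>_::nat. unit_interval"
    by (simp add: product_sigma_finite_def prob_space_unit_interval prob_space_imp_sigma_finite)
  have 1: "unit_cube 1 = Pi\<^sub>M {0} (\<lambda>_. unit_interval)"
    unfolding unit_cube_def by (simp add: lessThan_Suc)
  have [measurable]: "Measurable.pred unit_interval P"
    unfolding unit_interval_def by (rule measurable_restrict_space1) simp
  have "measure unit_interval {s\<in>space unit_interval. P s}
    = measure (distr (unit_cube 1) unit_interval (\<lambda>t. t 0)) {s\<in>space unit_interval. P s}"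
    unfolding 1 by (simp only: distr_singleton)
  also have "\<dots> = measure (unit_cube 1) ((\<lambda>t. t 0) -` {s\<in>space unit_interval. P s} \<inter> space (unit_cube 1))"
    unfolding 1 by (rule measure_distr) measurable
  also have "(\<lambda>t. t 0) -` {s\<in>space unit_interval. P s} \<inter> space (unit_cube 1)
    = {t\<in>space (unit_cube 1). P (t 0)}"
    unfolding 1 by (auto simp: space_PiM)
  finally have "measure (unit_cube 1) {t\<in>space (unit_cube 1). P (t 0)} = measure unit_interval {s\<in>{0..1}. P s}"
    by (simp add: space_unit_interval)
  also have "\<dots> = measure lborel {s\<in>{0..1}. P s}"
    unfolding unit_interval_def by (rule measure_restrict_space) auto
  finally show ?thesis .
qed

text \<open>Monomials of \<open>F\<close> with the same image are collected, which bounds the number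
  of frequencies by the number of terms of \<open>F\<close>.\<close>

lemma torus_value_row:
  assumes "dim_row A = 1"
  shows "torus_value F A t = trig_sum ((\<lambda>m. Poly_Mapping.lookup (mat_exponent A m) 0) ` Poly_Mapping.keys F)
    (\<lambda>j. \<Sum>m\<in>{m\<in>Poly_Mapping.keys F. Poly_Mapping.lookup (mat_exponent A m) 0 = j}. Poly_Mapping.lookup F m) (t 0)"
proof -
  let ?\<phi> = "\<lambda>m. Poly_Mapping.lookup (mat_exponent A m) 0"
  have "torus_value F A t
    = (\<Sum>m\<in>Poly_Mapping.keys F. Poly_Mapping.lookup F m * cis (2 * pi * (of_int (?\<phi> m) * t 0)))"
    using assms by (simp add: torus_value_def character_def)
  also have "\<dots> = (\<Sum>j\<in>?\<phi> ` Poly_Mapping.keys F. \<Sum>m\<in>{m\<in>Poly_Mapping.keys F. ?\<phi> m = j}.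
      Poly_Mapping.lookup F m * cis (2 * pi * (of_int (?\<phi> m) * t 0)))"
    by (rule sum.image_gen) simp
  finally show ?thesis by (simp add: trig_sum_def sum_distrib_right)
qed

text \<open>
  The constants are uniform in \<open>A\<close>: the number of terms is bounded by that of \<open>F\<close>, and the
  coefficients after collecting terms are subset sums of the coefficients of \<open>F\<close>.
\<close>

lemma torus_value_row_small_values:
  obtains C a where "C \<ge> 0" "a > 0"
    "\<And>A x. \<lbrakk>dim_row A = 1; laurent_subst F A \<noteq> 0; x > 0\<rbrakk> \<Longrightarrow>
       measure (unit_cube 1) {t\<in>space (unit_cube 1). (cmod (torus_value F A t))\<^sup>2 \<le> x} \<le> C * x powr a"
proof -
  let ?K = "Poly_Mapping.keys F"
  obtain C a where Ca: "C \<ge> 1" "0 < a" "small_value_bound (card ?K) C a"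
    using small_value_bound_exists by blast
  define S where "S = {cmod (\<Sum>m\<in>T. Poly_Mapping.lookup F m) | T. T \<subseteq> ?K \<and> (\<Sum>m\<in>T. Poly_Mapping.lookup F m) \<noteq> 0}"
  have "S \<subseteq> (\<lambda>T. cmod (\<Sum>m\<in>T. Poly_Mapping.lookup F m)) ` Pow ?K" by (auto simp: S_def)
  then have finS: "finite S" by (rule finite_subset) simp
  \<comment> \<open>A positive lower bound for all nonzero subset sums; the inserted 1 keeps the
    minimum defined when \<open>S\<close> is empty.\<close>
  define c where "c = Min (insert 1 S)"
  have c: "c > 0" unfolding c_def using finS by (subst Min_gr_iff) (auto simp: S_def)
  have cS: "c \<le> s" if "s \<in> S" for s unfolding c_def using finS that by (intro Min_le) auto
  show ?thesis
  proof (rule that)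
    show "0 \<le> C * (1 / c) powr a" using Ca by simp
    show "0 < a / 2" using Ca by simp
    fix A :: "int mat" and x :: real
    assume A: "dim_row A = 1" "laurent_subst F A \<noteq> 0" and x: "x > 0"
    define J where "J = (\<lambda>m. Poly_Mapping.lookup (mat_exponent A m) 0) ` ?K"
    define b where "b = (\<lambda>j. \<Sum>m\<in>{m\<in>?K. Poly_Mapping.lookup (mat_exponent A m) 0 = j}. Poly_Mapping.lookup F m)"
    have tv: "torus_value F A t = trig_sum J b (t 0)" for t
      unfolding J_def b_def by (rule torus_value_row[OF A(1)])
    \<comment> \<open>Nonvanishing of the substituted polynomial supplies one collected coefficient
      that is nonzero, hence of modulus at least \<open>c\<close>.\<close>
    obtain m where m: "m \<in> ?K"
      "(\<Sum>m'\<in>{m'\<in>?K. mat_exponent A (m' - m) = 0}. Poly_Mapping.lookup F m') \<noteq> 0"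
      using A(2) unfolding laurent_subst_eq_0_iff by blast
    have "mat_exponent A (m' - m) = 0 \<longleftrightarrow>
        Poly_Mapping.lookup (mat_exponent A m') 0 = Poly_Mapping.lookup (mat_exponent A m) 0" for m'
      unfolding mat_exponent_diff using A(1)
      by (auto simp: poly_mapping_eq_iff fun_eq_iff lookup_minus lookup_mat_exponent)
    then have bm: "b (Poly_Mapping.lookup (mat_exponent A m) 0) \<noteq> 0"
      using m(2) by (simp add: b_def)
    then have "cmod (b (Poly_Mapping.lookup (mat_exponent A m) 0)) \<in> S"
      unfolding S_def b_def by blast
    then have "\<exists>j\<in>J. c \<le> cmod (b j)" using cS m(1) by (auto simp: J_def)
    moreover have "finite J" "card J \<le> card ?K" by (auto simp: J_def card_image_le)
    \<comment> \<open>With this relative threshold the bound on the modulus is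
      \<open>sqrt x\<close>, as required for the square; the exponent \<open>a\<close> therefore
      becomes \<open>a / 2\<close>.\<close>
    moreover have "sqrt x / c > 0" using x c by simp
    ultimately have bd: "emeasure lborel {s\<in>{0..1}. cmod (trig_sum J b s) \<le> c * (sqrt x / c)}
       \<le> ennreal (C * (sqrt x / c) powr a)"
      using Ca(3) c unfolding small_value_bound_def by blast
    have pred: "Measurable.pred borel (\<lambda>s. (cmod (trig_sum J b s))\<^sup>2 \<le> x)" by measurable
    have "measure (unit_cube 1) {t\<in>space (unit_cube 1). (cmod (torus_value F A t))\<^sup>2 \<le> x}
      = measure lborel {s\<in>{0..1}. (cmod (trig_sum J b s))\<^sup>2 \<le> x}"
      unfolding tv by (rule measure_unit_cube_1[OF pred])
    also have "{s\<in>{0..1}. (cmod (trig_sum J b s))\<^sup>2 \<le> x}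
      = {s\<in>{0..1}. cmod (trig_sum J b s) \<le> c * (sqrt x / c)}"
      unfolding real_sqrt_le_iff[symmetric, of _ x] using c by simp
    also have "measure lborel \<dots> \<le> C * (sqrt x / c) powr a"
      unfolding measure_def using bd Ca(1) by (intro enn2real_leI) auto
    also have "sqrt x / c = x powr (1 / 2) * (1 / c)" using x by (simp add: powr_half_sqrt)
    also have "C * (x powr (1 / 2) * (1 / c)) powr a = C * (1 / c) powr a * x powr (a / 2)"
      unfolding powr_mult powr_powr by (simp add: mult_ac)
    finally show "measure (unit_cube 1) {t\<in>space (unit_cube 1). (cmod (torus_value F A t))\<^sup>2 \<le> x}
      \<le> C * (1 / c) powr a * x powr (a / 2)" .
  qed
qed

text \<open>The moments are eventually equal, and the small value bound is uniform over all
  nonvanishing one-row substitutions. It is needed along the sequence only, so \<open>A\<close> may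
  have any number of rows.\<close>

lemma mahler_measure_tendsto:
  assumes F: "F \<in> laurent_polys k" and A: "A \<in> carrier_mat l k"
    and R: "\<And>n. R n \<in> carrier_mat 1 k" and nz: "\<And>n. laurent_subst F (R n) \<noteq> 0"
    and same: "same_relations k R A"
  shows "(\<lambda>n. mahler_measure 1 (laurent_subst F (R n))) \<longlonglongrightarrow> mahler_measure l (laurent_subst F A)"
proof -
  obtain C a where C: "C \<ge> 0" and a: "a > 0"
    and tail: "\<And>A x. \<lbrakk>dim_row A = 1; laurent_subst F A \<noteq> 0; x > 0\<rbrakk> \<Longrightarrow>
       measure (unit_cube 1) {t\<in>space (unit_cube 1). (cmod (torus_value F A t))\<^sup>2 \<le> x} \<le> C * x powr a"
    using torus_value_row_small_values by blast
  define K where "K = (\<Sum>m\<in>Poly_Mapping.keys F. cmod (Poly_Mapping.lookup F m))\<^sup>2"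
  have dims: "dim_row A = l" "dim_row (R n) = 1" for n using A R[of n] by auto
  have bd: "(cmod (torus_value F B t))\<^sup>2 \<in> {0..K}" for B t
    using norm_torus_value_le[of F B t] by (auto simp: K_def intro: power_mono)
  have meas: "torus_value F A \<in> borel_measurable (unit_cube l)"
    "torus_value F (R n) \<in> borel_measurable (unit_cube 1)" for n
    using torus_value_measurable[of F A] torus_value_measurable[of F "R n"] by (simp_all only: dims)
  have "(\<lambda>n. \<integral>t. ln ((cmod (torus_value F (R n) t))\<^sup>2) \<partial>unit_cube 1)
     \<longlonglongrightarrow> (\<integral>t. ln ((cmod (torus_value F A t))\<^sup>2) \<partial>unit_cube l)"
  proof (rule tendsto_expectation_ln_of_moments)
    show "(\<lambda>n. \<integral>t. ((cmod (torus_value F (R n) t))\<^sup>2) ^ j \<partial>unit_cube 1)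
       \<longlonglongrightarrow> (\<integral>t. ((cmod (torus_value F A t))\<^sup>2) ^ j \<partial>unit_cube l)" for j
      by (rule tendsto_eventually[OF torus_value_moments_eq[OF F A R same]])
    show "(\<lambda>t. (cmod (torus_value F A t))\<^sup>2) \<in> borel_measurable (unit_cube l)"
      "(\<lambda>t. (cmod (torus_value F (R n) t))\<^sup>2) \<in> borel_measurable (unit_cube 1)" for n
      using meas by measurable
    show "measure (unit_cube 1) {t\<in>space (unit_cube 1). (cmod (torus_value F (R n) t))\<^sup>2 \<le> x} \<le> C * x powr a"
      if "x > 0" for n x
      using tail[OF dims(2) nz that] .
  qed (use prob_space_unit_cube bd a C in auto)
  then show ?thesis
    unfolding mahler_measure_subst[OF A] mahler_measure_subst[OF R] by (intro tendsto_divide) auto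
qed

theorem theorem1:
  fixes k :: nat and F :: laurent
  assumes "k \<ge> 1"
    and "F \<in> laurent_polys k"
    and "F \<noteq> 0"
  shows "closed (mahler_set k F) \<and> mahler_set k F = closure (mahler_set1 k F)"
proof -
  have row: "mat_of_row r \<in> carrier_mat 1 k" if "r \<in> carrier_vec k" for r :: "int Matrix.vec"
    using that by (auto simp: mat_of_row_def)
  have "mahler_set k F \<subseteq> closure (mahler_set1 k F)"
  proof
    fix x assume "x \<in> mahler_set k F"
    then obtain l A where A: "A \<in> carrier_mat l k" "laurent_subst F A \<noteq> 0"
      and x: "x = mahler_measure l (laurent_subst F A)"
      by (auto simp: mahler_set_def)
    obtain r where r: "\<And>n. r n \<in> carrier_vec k" and same: "same_relations k (\<lambda>n. mat_of_row (r n)) A"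
      using same_relations_row_sequence[OF A(1)] by blast
    obtain N where N: "\<And>n. n \<ge> N \<Longrightarrow> laurent_subst F (mat_of_row (r n)) \<noteq> 0"
      using same_relations_laurent_subst_eq_0[OF assms(2) same] A(2)
      by (auto simp: eventually_sequentially)
    \<comment> \<open>The first \<open>N\<close> rows, for which the substitution might vanish, are
      discarded.\<close>
    define s where "s = (\<lambda>n. r (n + N))"
    have "same_relations k (\<lambda>n. mat_of_row (s n)) A"
      using same unfolding same_relations_def s_def
      by (auto intro: eventually_sequentially_seg[THEN iffD2])
    then have "(\<lambda>n. mahler_measure 1 (laurent_subst F (mat_of_row (s n)))) \<longlonglongrightarrow> x"
      unfolding x by (intro mahler_measure_tendsto[OF assms(2) A(1)] row) (auto simp: s_def r N)
    moreover have "mahler_measure 1 (laurent_subst F (mat_of_row (s n))) \<in> mahler_set1 k F" for n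
      unfolding mahler_set1_def s_def using r N[of "n + N"] by auto
    ultimately show "x \<in> closure (mahler_set1 k F)"
      unfolding closure_sequential
      by (intro exI[of _ "\<lambda>n. mahler_measure 1 (laurent_subst F (mat_of_row (s n)))"]) auto
  qed
  moreover have "closure (mahler_set1 k F) \<subseteq> mahler_set k F"
  proof
    fix x assume "x \<in> closure (mahler_set1 k F)"
    then obtain f where f: "\<And>n. f n \<in> mahler_set1 k F" "f \<longlonglongrightarrow> x"
      unfolding closure_sequential by blast
    have "\<forall>n. \<exists>r. r \<in> carrier_vec k \<and> laurent_subst F (mat_of_row r) \<noteq> 0
        \<and> f n = mahler_measure 1 (laurent_subst F (mat_of_row r))"
      using f(1) by (auto simp: mahler_set1_def)
    then obtain r where r: "\<And>n. r n \<in> carrier_vec k" "\<And>n. laurent_subst F (mat_of_row (r n)) \<noteq> 0"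
      and fr: "\<And>n. f n = mahler_measure 1 (laurent_subst F (mat_of_row (r n)))"
      by metis
    obtain \<sigma> l A where \<sigma>: "strict_mono \<sigma>" and A: "A \<in> carrier_mat l k"
      and same: "same_relations k (\<lambda>n. mat_of_row (r (\<sigma> n))) A"
      by (rule same_relations_subsequence[OF r(1)])
    have "(\<lambda>n. f (\<sigma> n)) \<longlonglongrightarrow> mahler_measure l (laurent_subst F A)"
      unfolding fr by (intro mahler_measure_tendsto[OF assms(2) A] row r same)
    moreover have "(\<lambda>n. f (\<sigma> n)) \<longlonglongrightarrow> x"
      using LIMSEQ_subseq_LIMSEQ[OF f(2) \<sigma>] by (simp add: o_def)
    ultimately have "x = mahler_measure l (laurent_subst F A)"
      using LIMSEQ_unique by blast
    \<comment> \<open>Vanishing for \<open>A\<close> would force vanishing for all late members of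
      the subsequence.\<close>
    moreover have "laurent_subst F A \<noteq> 0"
      using same_relations_laurent_subst_eq_0[OF assms(2) same] r(2) by (auto simp: eventually_sequentially)
    ultimately show "x \<in> mahler_set k F"
      using A by (auto simp: mahler_set_def)
  qed
  ultimately show ?thesis by (metis closed_closure subset_antisym)
qed

end
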